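(* Let $u_\phi \in \mathbb{R}$ be any constant (viewed as a constant solution of the Fowler equation $\partial_t u + \partial_x\left(\frac{u^2}{2}\right) + \mathcal{I}[u] - \partial_{xx}^2 u = 0$). Then $u_\phi$ is unstable in the following sense: there exists $\varepsilon > 0$ such that for every $\delta > 0$ there exist a (real-valued) initial perturbation $v_0 \in L^2(\mathbb{R})$ with $\|v_0\|_{L^2(\mathbb{R})} \le \delta$ and a time $t_0 > 0$ such that $\|v(t_0,\cdot)\|_{L^2(\mathbb{R})} > \varepsilon$, where $v$ is the solution of the Cauchy problem $$\partial_t v(t,x) + \partial_x\left(\frac{v^2}{2} + u_\phi v\right)(t,x) + \mathcal{I}[v(t,\cdot)](x) - \partial_{xx}^2 v(t,x) = 0, \qquad v(0,x) = v_0(x), \qquad x \in \mathbb{R}.$$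
   Context: The nonlocal operator $\mathcal{I}$ is defined for Schwartz functions $\varphi$ by $\mathcal{I}[\varphi](x) = \int_0^{+\infty} |\zeta|^{-1/3}\varphi''(x-\zeta)\,d\zeta$. With the Fourier transform $\mathcal{F}f(\xi) = \int_{\mathbb{R}} e^{-2i\pi x\xi} f(x)\,dx$ it satisfies $\mathcal{F}(\mathcal{I}[\varphi] - \varphi'')(\xi) = \psi_{\mathcal{I}}(\xi)\,\mathcal{F}\varphi(\xi)$ with $\psi_{\mathcal{I}}(\xi) = 4\pi^2\xi^2 - a_{\mathcal{I}}|\xi|^{4/3} + i\, b_{\mathcal{I}}\,\xi|\xi|^{1/3}$, where $a_{\mathcal{I}}, b_{\mathcal{I}} > 0$ are the positive constants determined by this identity. For a constant $u_\phi$, set $\phi_{\mathcal{I}}(\xi) = \psi_{\mathcal{I}}(\xi) + 2i\pi u_\phi \xi$ and $K(t,x) = \mathcal{F}^{-1}\left(e^{-t\phi_{\mathcal{I}}(\cdot)}\right)(x)$ for $t>0$. Notion of solution (mild solution): for $T>0$ and $v_0 \in L^2(\mathbb{R})$, a function $v \in L^\infty((0,T);L^2(\mathbb{R}))$ is a mild solution of the Cauchy problem on $(0,T)$ if for every $t \in (0,T)$, $$v(t,x) = K(t,\cdot) * v_0(x) - \int_0^t \partial_x K(t-s,\cdot) * \left(\frac{v^2}{2}\right)(s,\cdot)(x)\,ds,$$ where $*$ is convolution in $x$. It is known that for every $v_0 \in L^2(\mathbb{R})$ there is a unique global mild solution, i.e. a unique $v$ defined for all $t>0$ which is a mild solution on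 $(0,T)$ for every $T>0$; "the solution" in the claim means this one. *)

theory Defs
  imports "HOL-Analysis.Analysis"
begin

definition fourier :: "(real \<Rightarrow> complex) \<Rightarrow> real \<Rightarrow> complex" where
  "fourier f \<xi> = (LINT x|lborel. exp (- (2 * \<i> * of_real pi * of_real x * of_real \<xi>)) * f x)"

definition inverse_fourier :: "(real \<Rightarrow> complex) \<Rightarrow> real \<Rightarrow> complex" where
  "inverse_fourier g x = (LINT \<xi>|lborel. exp (2 * \<i> * of_real pi * of_real x * of_real \<xi>) * g \<xi>)"

definition convolution :: "(real \<Rightarrow> complex) \<Rightarrow> (real \<Rightarrow> complex) \<Rightarrow> real \<Rightarrow> complex" where
  "convolution f g x = (LINT y|lborel. f (x - y) * g y)"

definition derivative :: "(real \<Rightarrow> complex) \<Rightarrow> real \<Rightarrow> complex" where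
  "derivative f x = vector_derivative f (at x)"

definition schwartz :: "(real \<Rightarrow> complex) \<Rightarrow> bool" where
  "schwartz f \<longleftrightarrow>
     (\<forall>n x. (derivative ^^ n) f differentiable (at x)) \<and>
     (\<forall>k n. \<exists>C. \<forall>x. \<bar>x\<bar> ^ k * norm ((derivative ^^ n) f x) \<le> C)"

definition nonlocal_op :: "(real \<Rightarrow> complex) \<Rightarrow> real \<Rightarrow> complex" where
  "nonlocal_op f x =
     (LINT \<zeta>:{0<..}|lborel. of_real (\<bar>\<zeta>\<bar> powr (-1/3)) * (derivative ^^ 2) f (x - \<zeta>))"

definition fowler_psi :: "real \<Rightarrow> real \<Rightarrow> real \<Rightarrow> complex" where
  "fowler_psi a b \<xi> =
     of_real (4 * pi\<^sup>2 * \<xi>\<^sup>2 - a * \<bar>\<xi>\<bar> powr (4/3)) + \<i> * of_real (b * \<xi> * \<bar>\<xi>\<bar> powr (1/3))"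

text \<open>
  Evaluating the symbol of the nonlocal operator shows that exactly one pair
  \<open>(a, b)\<close> has this property.
\<close>
definition fowler_constants :: "real \<Rightarrow> real \<Rightarrow> bool" where
  "fowler_constants a b \<longleftrightarrow> 0 < a \<and> 0 < b \<and>
     (\<forall>f. schwartz f \<longrightarrow>
        (\<forall>\<xi>. fourier (\<lambda>x. nonlocal_op f x - (derivative ^^ 2) f x) \<xi>
             = fowler_psi a b \<xi> * fourier f \<xi>))"

definition fowler_phi :: "real \<Rightarrow> real \<Rightarrow> real \<Rightarrow> real \<Rightarrow> complex" where
  "fowler_phi a b u \<xi> = fowler_psi a b \<xi> + 2 * \<i> * of_real pi * of_real u * of_real \<xi>"

text \<open>
  The symbol is Hermitian (its value at \<open>- \<xi>\<close> is the conjugate of that at \<open>\<xi>\<close>), so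
  the kernel takes real values although its type is complex.
\<close>
definition fowler_kernel :: "real \<Rightarrow> real \<Rightarrow> real \<Rightarrow> real \<Rightarrow> real \<Rightarrow> complex" where
  "fowler_kernel a b u t =
     inverse_fourier (\<lambda>\<xi>. exp (- (of_real t * fowler_phi a b u \<xi>)))"

definition in_L2 :: "(real \<Rightarrow> real) \<Rightarrow> bool" where
  "in_L2 f \<longleftrightarrow> f \<in> borel_measurable lborel \<and> integrable lborel (\<lambda>x. (f x)\<^sup>2)"

definition L2_norm :: "(real \<Rightarrow> real) \<Rightarrow> real" where
  "L2_norm f = sqrt (LINT x|lborel. (f x)\<^sup>2)"

text \<open>
  \<open>L\<^sup>\<infinity>((0,T); L\<^sup>2(\<real>))\<close>: since \<open>L\<^sup>2(\<real>)\<close> is separable, strong measurability in time is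
  rendered by joint measurability of the representative in both variables.
\<close>
definition in_Linf_L2 :: "real \<Rightarrow> (real \<Rightarrow> real \<Rightarrow> real) \<Rightarrow> bool" where
  "in_Linf_L2 T v \<longleftrightarrow>
     set_borel_measurable (lborel \<Otimes>\<^sub>M lborel) ({0<..<T} \<times> UNIV) (\<lambda>(t, x). v t x) \<and>
     (\<forall>t\<in>{0<..<T}. in_L2 (v t)) \<and>
     (\<exists>C. AE t in lborel. t \<in> {0<..<T} \<longrightarrow> L2_norm (v t) \<le> C)"

text \<open>
  For each time, the identity is one between elements of \<open>L\<^sup>2(\<real>)\<close>, hence holds for almost
  every \<open>x\<close>.  The time integral is taken pointwise in \<open>x\<close>; it converges absolutely
  for almost every \<open>x\<close> and agrees with the \<open>L\<^sup>2\<close>-valued integral.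
\<close>
definition mild_solution_on ::
  "real \<Rightarrow> real \<Rightarrow> real \<Rightarrow> real \<Rightarrow> (real \<Rightarrow> real) \<Rightarrow> (real \<Rightarrow> real \<Rightarrow> real) \<Rightarrow> bool" where
  "mild_solution_on a b u T v0 v \<longleftrightarrow>
     in_Linf_L2 T v \<and>
     (\<forall>t\<in>{0<..<T}. AE x in lborel.
        complex_of_real (v t x) =
          convolution (fowler_kernel a b u t) (\<lambda>y. of_real (v0 y)) x
          - (LINT s:{0<..<t}|lborel.
               convolution (derivative (fowler_kernel a b u (t - s)))
                 (\<lambda>y. of_real ((v s y)\<^sup>2 / 2)) x))"

definition global_mild_solution ::
  "real \<Rightarrow> real \<Rightarrow> real \<Rightarrow> (real \<Rightarrow> real) \<Rightarrow> (real \<Rightarrow> real \<Rightarrow> real) \<Rightarrow> bool" where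
  "global_mild_solution a b u v0 v \<longleftrightarrow> (\<forall>T>0. mild_solution_on a b u T v0 v)"

end

theory Submission
  imports Defs "HOL-Probability.Sinc_Integral" "HOL-Probability.Characteristic_Functions"
    "HOL-Real_Asymp.Real_Asymp"
begin

text \<open>
  The real part of the symbol has the negative minimum \<open>- \<Lambda>\<close>, attained at \<open>\<plusminus> \<xi>max\<close>, so the linear
  evolution amplifies a sufficiently wide wave packet of frequency \<open>\<xi>max\<close> and norm \<open>\<delta>\<close> like
  \<open>\<delta> exp (\<Lambda> t)\<close> up to a prescribed time.  The kernel derivative has \<open>L\<^sup>2\<close> norm at most
  \<open>C t\<^bsup>-3/4\<^esup> exp (3 \<Lambda> t / 2)\<close>, and \<open>3/2 < 2\<close>: as long as \<open>v\<close> is of size \<open>\<delta> exp (\<Lambda> t)\<close>, the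
  Duhamel term is \<open>O(\<delta>\<^sup>2 exp (2 \<Lambda> t))\<close>, hence dominated by the linear part until
  \<open>\<delta> exp (\<Lambda> t)\<close> reaches a threshold \<open>\<epsilon>0\<close> that does not depend on \<open>\<delta>\<close>.  The time at which this
  happens is \<open>t0\<close>.
\<close>

section \<open>Gaussians, Fourier inversion bounds and Minkowski's inequality\<close>

text \<open>The rate 3/2 is a compromise. Pointwise in frequency the evolution grows at most like
  exp (\<Lambda> t), but a bound that also keeps Gaussian decay in \<xi> is paid for with rate 5/4
  \<Lambda>, and absorbing a factor 1 + t in the squared norm costs another \<Lambda>/4. The sum is
  still below 2 \<Lambda>, so convolving in time with exp (2 \<Lambda> s) returns exp (2 \<Lambda>
  t) times a convergent integral; this yields one constant \<open>J\<close> valid for all times, and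
  the threshold is 1 / (128 J). Two difficulties shape the linear part. Real initial data carry the
  frequencies \<open>\<xi>max\<close> and \<open>- \<xi>max\<close> together, with a relative phase
  that turns in time, so their interference has to be small for every phase. Moreover a packet of
  finite width R contains other frequencies: its deviation from pure exponential growth has squared
  norm O(1/R), against a squared norm of order R for the packet. The bound on the deviation depends
  on the time horizon, which is why the width is chosen last, after \<delta> and the final
  time.\<close>

text \<open>Scaling by c = sqrt (2 \<alpha>) turns the standard normal density into a multiple of
  this Gaussian, so integrability and the transform come from the moments and the characteristic
  function of the normal distribution.\<close>

lemma gaussian_scaled:
  fixes \<alpha> \<beta> :: real
  assumes "0 < \<alpha>"
  shows gaussian_integrable: "integrable lborel (\<lambda>x. exp (- \<alpha> * x\<^sup>2) :: real)"
    and gaussian_fourier: "(LINT x|lborel. exp (\<i> * of_real (\<beta> * x)) * of_real (exp (- \<alpha> * x\<^sup>2)))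
           = complex_of_real (sqrt (pi / \<alpha>) * exp (- (\<beta>\<^sup>2 / (4 * \<alpha>))))"
proof -
  define c where "c = sqrt (2 * \<alpha>)"
  have c: "c > 0" "c\<^sup>2 = 2 * \<alpha>" using assms by (auto simp: c_def)
  have dens: "std_normal_density (0 + c * x) = 1 / sqrt (2 * pi) * exp (- \<alpha> * x\<^sup>2)" for x
    by (simp add: std_normal_density_def power_mult_distrib c)
  have "integrable lborel std_normal_density"
    using integrable_std_normal_moment[of 0] by simp
  from lborel_integrable_real_affine[OF this, of c 0] c(1)
  have "integrable lborel (\<lambda>x. 1 / sqrt (2 * pi) * exp (- \<alpha> * x\<^sup>2))"
    by (simp only: dens)
  from integrable_mult_right[OF this, of "sqrt (2 * pi)"]
  show "integrable lborel (\<lambda>x. exp (- \<alpha> * x\<^sup>2) :: real)" by simp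
  have "complex_of_real (exp (- ((\<beta> / c)^2) / 2)) = char std_normal_distribution (\<beta> / c)"
    by (simp add: char_std_normal_distribution)
  also have "\<dots> = (LINT x|lborel. std_normal_density x *\<^sub>R iexp (\<beta> / c * x))"
    unfolding char_def by (subst integral_density) auto
  also have "\<dots> = c *\<^sub>R (LINT x|lborel. std_normal_density (0 + c * x) *\<^sub>R iexp (\<beta> / c * (0 + c * x)))"
    using c(1) by (subst lborel_integral_real_affine[where c=c and t=0]) auto
  also have "\<dots> = c *\<^sub>R (LINT x|lborel. complex_of_real (1 / sqrt (2 * pi)) * (iexp (\<beta> * x) * of_real (exp (- \<alpha> * x\<^sup>2))))"
    unfolding dens using c(1) by (intro arg_cong[where f="\<lambda>z. c *\<^sub>R z"] Bochner_Integration.integral_cong)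
      (auto simp: scaleR_conv_of_real field_simps)
  also have "\<dots> = of_real (c / sqrt (2 * pi)) * (LINT x|lborel. (iexp (\<beta> * x) * of_real (exp (- \<alpha> * x\<^sup>2))))"
    by (simp add: scaleR_conv_of_real)
  finally have *: "of_real (c / sqrt (2 * pi)) * (LINT x|lborel. (iexp (\<beta> * x) * of_real (exp (- \<alpha> * x\<^sup>2))))
      = complex_of_real (exp (- ((\<beta> / c)^2) / 2))" ..
  have cc: "c / sqrt (2 * pi) = sqrt (\<alpha> / pi)"
    by (simp add: c_def flip: real_sqrt_divide)
  have "sqrt (pi / \<alpha>) * (c / sqrt (2 * pi)) = 1"
    unfolding cc using assms by (simp flip: real_sqrt_mult)
  then have 1: "complex_of_real (sqrt (pi / \<alpha>)) * of_real (c / sqrt (2 * pi)) = 1"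
    by (metis of_real_1 of_real_mult)
  have "(LINT x|lborel. (iexp (\<beta> * x) * of_real (exp (- \<alpha> * x\<^sup>2))))
      = complex_of_real (sqrt (pi / \<alpha>)) * (of_real (c / sqrt (2 * pi)) * (LINT x|lborel. (iexp (\<beta> * x) * of_real (exp (- \<alpha> * x\<^sup>2)))))"
    using 1 by (simp add: mult.assoc[symmetric])
  also have "\<dots> = complex_of_real (sqrt (pi / \<alpha>) * exp (- ((\<beta> / c)^2) / 2))"
    unfolding * by simp
  also have "- ((\<beta> / c)^2) / 2 = - (\<beta>\<^sup>2 / (4 * \<alpha>))"
    by (simp add: power_divide c)
  finally show "(LINT x|lborel. exp (\<i> * of_real (\<beta> * x)) * of_real (exp (- \<alpha> * x\<^sup>2)))
           = complex_of_real (sqrt (pi / \<alpha>) * exp (- (\<beta>\<^sup>2 / (4 * \<alpha>))))" .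
qed

lemma gaussian_integral:
  assumes "0 < (\<alpha> :: real)"
  shows "(LINT x|lborel. exp (- \<alpha> * x\<^sup>2)) = sqrt (pi / \<alpha>)"
proof -
  have "complex_of_real (LINT x|lborel. exp (- \<alpha> * x\<^sup>2)) = complex_of_real (sqrt (pi / \<alpha>))"
    using gaussian_fourier[OF assms, of 0] by simp
  then show ?thesis using of_real_eq_iff by blast
qed

lemma gaussian_shifted:
  assumes "0 < (\<alpha> :: real)"
  shows gaussian_shifted_integrable: "integrable lborel (\<lambda>x. exp (- \<alpha> * (x - k)\<^sup>2))"
    and gaussian_shifted_integral: "(LINT x|lborel. exp (- \<alpha> * (x - k)\<^sup>2)) = sqrt (pi / \<alpha>)"
  using lborel_integrable_real_affine[OF gaussian_integrable[OF assms], of 1 "-k"]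
    lborel_integral_real_affine[of 1 "\<lambda>x. exp (- \<alpha> * x\<^sup>2)" "-k"] gaussian_integral[OF assms]
  by (simp_all add: algebra_simps)

section \<open>Square-integrability from pointwise decay\<close>

lemma nn_integral_inverse_1_plus_square:
  "(\<integral>\<^sup>+x. ennreal (1 / (1 + x\<^sup>2)) \<partial>lborel) = pi"
proof -
  have "integrable lborel (\<lambda>x::real. inverse (1 + x\<^sup>2))"
    using integrable_inverse_1_plus_square by (simp add: set_integrable_def)
  moreover have "(LINT x|lborel. inverse (1 + x\<^sup>2)) = pi"
    using LBINT_inverse_1_plus_square
    by (simp add: interval_lebesgue_integral_def set_lebesgue_integral_def)
  ultimately show ?thesis
    by (subst nn_integral_eq_integral) (auto simp: inverse_eq_divide)
qed

text \<open>The bounds A and B/|x| cross at |x| = B/A. With c = A/B, together they put |f|^2 below 2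
  A^2 / (1 + (c x)^2), whose integral is 2 A^2 pi / c = 2 pi A B.\<close>

lemma nn_integral_square_le_of_decay:
  fixes f :: "real \<Rightarrow> complex"
  assumes A: "\<And>x. norm (f x) \<le> A" and B: "\<And>x. \<bar>x\<bar> * norm (f x) \<le> B" and pos: "0 < A" "0 < B"
  shows "(\<integral>\<^sup>+x. ennreal ((norm (f x))\<^sup>2) \<partial>lborel) \<le> ennreal (2 * pi * A * B)"
proof -
  define c where "c = A / B"
  have c: "c > 0" using pos by (simp add: c_def)
  have "(norm (f x))\<^sup>2 \<le> 2 * A\<^sup>2 * (1 / (1 + (0 + c * x)\<^sup>2))" for x
  proof -
    have "(norm (f x))\<^sup>2 \<le> A\<^sup>2" using A by (intro power_mono) auto
    moreover have "(\<bar>x\<bar> * norm (f x))\<^sup>2 \<le> B\<^sup>2" using B by (intro power_mono) auto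
    then have "c\<^sup>2 * (x\<^sup>2 * (norm (f x))\<^sup>2) \<le> c\<^sup>2 * B\<^sup>2"
      by (intro mult_left_mono) (auto simp: power_mult_distrib)
    moreover have "c\<^sup>2 * B\<^sup>2 = A\<^sup>2" using pos by (simp add: c_def power_divide)
    ultimately have "(norm (f x))\<^sup>2 * (1 + (c * x)\<^sup>2) \<le> 2 * A\<^sup>2"
      by (simp add: algebra_simps power_mult_distrib)
    moreover have "0 < 1 + (c * x)\<^sup>2" by (simp add: add_pos_nonneg)
    ultimately show ?thesis by (simp add: field_simps)
  qed
  then have "(\<integral>\<^sup>+x. ennreal ((norm (f x))\<^sup>2) \<partial>lborel)
      \<le> (\<integral>\<^sup>+x. ennreal (2 * A\<^sup>2) * ennreal (1 / (1 + (0 + c * x)\<^sup>2)) \<partial>lborel)"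
    by (intro nn_integral_mono) (subst ennreal_mult'[symmetric], auto simp: ennreal_leI)
  also have "\<dots> = ennreal (2 * A\<^sup>2) * (\<integral>\<^sup>+x. ennreal (1 / (1 + (0 + c * x)\<^sup>2)) \<partial>lborel)"
    by (subst nn_integral_cmult) auto
  also have "(\<integral>\<^sup>+x. ennreal (1 / (1 + (0 + c * x)\<^sup>2)) \<partial>lborel) = ennreal (pi / c)"
  proof -
    have "ennreal pi = ennreal c * (\<integral>\<^sup>+x. ennreal (1 / (1 + (0 + c * x)\<^sup>2)) \<partial>lborel)"
      using nn_integral_real_affine[of "\<lambda>x. ennreal (1 / (1 + x\<^sup>2))" c 0] c
        nn_integral_inverse_1_plus_square by simp
    then have "ennreal (1 / c) * ennreal pi = ennreal (1 / c) * ennreal c * (\<integral>\<^sup>+x. ennreal (1 / (1 + (0 + c * x)\<^sup>2)) \<partial>lborel)"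
      by (simp add: mult.assoc)
    also have "ennreal (1 / c) * ennreal c = 1" using c by (simp flip: ennreal_mult)
    finally show ?thesis using c by (simp flip: ennreal_mult)
  qed
  also have "ennreal (2 * A\<^sup>2) * ennreal (pi / c) = ennreal (2 * pi * A * B)"
    using pos by (subst ennreal_mult[symmetric]) (auto simp: c_def power2_eq_square)
  finally show ?thesis .
qed

lemma integral_derivative_eq_0:
  fixes F f :: "real \<Rightarrow> complex"
  assumes F: "\<And>x. (F has_vector_derivative f x) (at x)" and f: "\<And>x. isCont f x" "integrable lborel f"
    and lim: "(F \<longlongrightarrow> 0) at_top" "(F \<longlongrightarrow> 0) at_bot"
  shows "(LINT x|lborel. f x) = 0"
proof -
  have "(LBINT x=-\<infinity>..\<infinity>. f x) = 0 - 0"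
  proof (rule interval_integral_FTC_integrable[where F=F])
    show "((F \<circ> real_of_ereal) \<longlongrightarrow> 0) (at_right (-\<infinity>))"
      using lim by (simp add: ereal_tendsto_simps1)
    show "((F \<circ> real_of_ereal) \<longlongrightarrow> 0) (at_left \<infinity>)"
      using lim by (simp add: ereal_tendsto_simps1)
  qed (use F f in \<open>auto simp: set_integrable_def\<close>)
  then show ?thesis by (simp add: interval_lebesgue_integral_def set_lebesgue_integral_def)
qed

lemma inverse_fourier_norm_le:
  assumes "integrable lborel g" "\<And>\<xi>. norm (h \<xi>) \<le> g \<xi>" "h \<in> borel_measurable borel"
  shows "norm (inverse_fourier h x) \<le> (LINT \<xi>|lborel. g \<xi>)"
  unfolding inverse_fourier_def
proof (rule order_trans[OF integral_norm_bound integral_mono_AE])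
  show "integrable lborel (\<lambda>\<xi>. norm (exp (2 * \<i> * complex_of_real pi * complex_of_real x * complex_of_real \<xi>) * h \<xi>))"
    using assms by (intro Bochner_Integration.integrable_bound[OF assms(1)]) (auto simp: norm_mult intro: order_trans[OF _ abs_ge_self])
qed (use assms in \<open>auto simp: norm_mult\<close>)

text \<open>Plancherel is not needed: both \<open>\<bar>f\<bar>\<close> and \<open>\<bar>x f\<bar>\<close> are controlled by
  \<open>L\<^sup>1\<close> norms on the Fourier side, and these two bounds already control the \<open>L\<^sup>2\<close> norm.\<close>
lemma inverse_fourier_L2_bound:
  fixes h h' :: "real \<Rightarrow> complex"
  assumes h: "\<And>\<xi>. (h has_vector_derivative h' \<xi>) (at \<xi>)" "\<And>\<xi>. isCont h' \<xi>"
    and bd: "\<And>\<xi>. norm (h \<xi>) \<le> C * exp (- \<alpha> * (\<xi> - k)\<^sup>2)" "\<And>\<xi>. norm (h' \<xi>) \<le> C' * exp (- \<alpha> * (\<xi> - k)\<^sup>2)"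
    and pos: "0 < \<alpha>" "0 < C" "0 < C'"
  shows "(\<integral>\<^sup>+x. ennreal ((norm (inverse_fourier h x))\<^sup>2) \<partial>lborel) \<le> ennreal (C * C' * pi / \<alpha>)"
proof -
  let ?G = "\<lambda>\<xi>. exp (- \<alpha> * (\<xi> - k)\<^sup>2)"
  have hc: "continuous_on UNIV h" using h(1)
    by (auto simp: continuous_on_eq_continuous_at intro: has_vector_derivative_continuous)
  have h'c: "continuous_on UNIV h'" using h(2) by (auto simp: continuous_on_eq_continuous_at)
  have [measurable]: "h \<in> borel_measurable borel" "h' \<in> borel_measurable borel"
    using hc h'c by (auto intro: borel_measurable_continuous_onI)
  have iG: "integrable lborel (\<lambda>\<xi>. c * ?G \<xi>)" for c
    using gaussian_shifted_integrable[OF pos(1)] by simp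
  have IG: "(LINT \<xi>|lborel. c * ?G \<xi>) = c * sqrt (pi / \<alpha>)" for c
    using gaussian_shifted_integral[OF pos(1)] by simp
  have ih: "integrable lborel (\<lambda>\<xi>. exp (2 * \<i> * of_real pi * of_real x * of_real \<xi>) * h \<xi>)" for x
    using iG[of C] bd(1) by (rule_tac Bochner_Integration.integrable_bound[OF iG[of C]])
      (auto simp: norm_mult intro!: AE_I2 order_trans[OF _ abs_ge_self])
  have ih': "integrable lborel (\<lambda>\<xi>. exp (2 * \<i> * of_real pi * of_real x * of_real \<xi>) * h' \<xi>)" for x
    using iG[of C'] bd(2) by (rule_tac Bochner_Integration.integrable_bound[OF iG[of C']])
      (auto simp: norm_mult intro!: AE_I2 order_trans[OF _ abs_ge_self])
  \<comment> \<open>Integration by parts: the derivative of the exponential times \<open>h\<close>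
    integrates to 0. Thus a sup bound for the inverse transform of \<open>h'\<close> becomes one for
    x times the inverse transform of \<open>h\<close>.\<close>
  have parts: "2 * \<i> * of_real pi * of_real x * inverse_fourier h x + inverse_fourier h' x = 0" for x
  proof -
    let ?e = "\<lambda>\<xi>. exp (2 * \<i> * of_real pi * of_real x * of_real \<xi>) :: complex"
    have d: "((\<lambda>\<xi>. ?e \<xi> * h \<xi>) has_vector_derivative
         (2 * \<i> * of_real pi * of_real x * (?e \<xi> * h \<xi>) + ?e \<xi> * h' \<xi>)) (at \<xi>)" for \<xi>
      by (rule derivative_eq_intros has_vector_derivative_real_field h(1) refl | simp)+
    have lim: "((\<lambda>\<xi>. C * ?G \<xi>) \<longlongrightarrow> 0) at_top" "((\<lambda>\<xi>. C * ?G \<xi>) \<longlongrightarrow> 0) at_bot"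
      using pos by real_asymp+
    have "(LINT \<xi>|lborel. 2 * \<i> * of_real pi * of_real x * (?e \<xi> * h \<xi>) + ?e \<xi> * h' \<xi>) = 0"
    proof (rule integral_derivative_eq_0[OF d])
      show "isCont (\<lambda>\<xi>. 2 * \<i> * of_real pi * of_real x * (?e \<xi> * h \<xi>) + ?e \<xi> * h' \<xi>) \<xi>" for \<xi>
        using hc h(2) by (intro continuous_intros) (auto simp: continuous_on_eq_continuous_at)
      show "((\<lambda>\<xi>. ?e \<xi> * h \<xi>) \<longlongrightarrow> 0) at_top"
        by (rule Lim_null_comparison[OF _ lim(1)]) (use bd(1) in \<open>auto simp: norm_mult\<close>)
      show "((\<lambda>\<xi>. ?e \<xi> * h \<xi>) \<longlongrightarrow> 0) at_bot"
        by (rule Lim_null_comparison[OF _ lim(2)]) (use bd(1) in \<open>auto simp: norm_mult\<close>)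
    qed (use ih ih' in auto)
    then show ?thesis using ih[of x] ih'[of x] unfolding inverse_fourier_def by (subst (asm) Bochner_Integration.integral_add) auto
  qed
  have B: "\<bar>x\<bar> * norm (inverse_fourier h x) \<le> C' * sqrt (pi / \<alpha>) / (2 * pi)" for x
  proof -
    have "norm (2 * \<i> * of_real pi * of_real x * inverse_fourier h x) = norm (inverse_fourier h' x)"
      using parts[of x] by (metis add_eq_0_iff norm_minus_cancel)
    also have "\<dots> \<le> C' * sqrt (pi / \<alpha>)"
      using inverse_fourier_norm_le[OF iG[of C'] bd(2)] IG[of C'] pos by simp
    finally show ?thesis by (simp add: norm_mult field_simps)
  qed
  have A: "norm (inverse_fourier h x) \<le> C * sqrt (pi / \<alpha>)" for x
    using inverse_fourier_norm_le[OF iG[of C] bd(1)] IG[of C] pos by simp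
  have "2 * pi * (C * sqrt (pi / \<alpha>)) * (C' * sqrt (pi / \<alpha>) / (2 * pi)) = C * C' * (sqrt (pi / \<alpha>))\<^sup>2"
    by (simp add: power2_eq_square del: real_sqrt_mult_self real_sqrt_abs2)
  also have "\<dots> = C * C' * pi / \<alpha>" using pos by simp
  finally have eq: "2 * pi * (C * sqrt (pi / \<alpha>)) * (C' * sqrt (pi / \<alpha>) / (2 * pi)) = C * C' * pi / \<alpha>" .
  show ?thesis
    using nn_integral_square_le_of_decay[OF A B] pos unfolding eq by (simp add: divide_pos_pos)
qed

lemma ennreal_power2_le_imp_le: "x \<le> y" if "x\<^sup>2 \<le> y\<^sup>2" for x y :: ennreal
proof (rule ccontr)
  assume "\<not> x \<le> y"
  then have xy: "y < x" by simp
  then obtain r where r: "y = ennreal r" "0 \<le> r" by (cases y) auto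
  show False
  proof (cases x)
    case (real s)
    then have "s\<^sup>2 \<le> r\<^sup>2" using that r by (simp add: ennreal_power)
    from power2_le_imp_le[OF this r(2)] show False using xy r real by (simp add: ennreal_less_iff)
  next
    case top
    then have "top \<le> ennreal (r\<^sup>2)" using that r by (simp add: ennreal_power)
    then show False by (simp add: top_unique)
  qed
qed

text \<open>The square of the inner integral is a double integral over z and w. Exchanging the order
  of integration leaves the integral over x of the product of two slices, which Cauchy-Schwarz
  bounds by \<open>g z * g w\<close>; this again factors as a square.\<close>

lemma minkowski_nn_integral:
  fixes f :: "'a \<Rightarrow> 'b \<Rightarrow> ennreal"
  assumes "sigma_finite_measure M" "sigma_finite_measure N"
    and f[measurable]: "case_prod f \<in> borel_measurable (N \<Otimes>\<^sub>M M)" and g[measurable]: "g \<in> borel_measurable N"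
    and bd: "\<And>z. z \<in> space N \<Longrightarrow> (\<integral>\<^sup>+x. (f z x)\<^sup>2 \<partial>M) \<le> (g z)\<^sup>2"
  shows "(\<integral>\<^sup>+x. (\<integral>\<^sup>+z. f z x \<partial>N)\<^sup>2 \<partial>M) \<le> (\<integral>\<^sup>+z. g z \<partial>N)\<^sup>2"
proof -
  interpret M: sigma_finite_measure M by fact
  interpret N: sigma_finite_measure N by fact
  interpret NM: pair_sigma_finite N M by standard
  have "(\<integral>\<^sup>+x. (\<integral>\<^sup>+z. f z x \<partial>N)\<^sup>2 \<partial>M) = (\<integral>\<^sup>+x. (\<integral>\<^sup>+z. (\<integral>\<^sup>+w. f z x * f w x \<partial>N) \<partial>N) \<partial>M)"
    by (intro nn_integral_cong) (simp add: nn_integral_cmult nn_integral_multc power2_eq_square)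
  also have "\<dots> = (\<integral>\<^sup>+z. (\<integral>\<^sup>+x. (\<integral>\<^sup>+w. f z x * f w x \<partial>N) \<partial>M) \<partial>N)"
    by (rule NM.Fubini') simp
  also have "\<dots> = (\<integral>\<^sup>+z. (\<integral>\<^sup>+w. (\<integral>\<^sup>+x. f z x * f w x \<partial>M) \<partial>N) \<partial>N)"
    by (rule nn_integral_cong, rule NM.Fubini') simp
  also have "\<dots> \<le> (\<integral>\<^sup>+z. (\<integral>\<^sup>+w. g z * g w \<partial>N) \<partial>N)"
  proof (intro nn_integral_mono)
    fix z w assume zw: "z \<in> space N" "w \<in> space N"
    have [measurable]: "f z \<in> borel_measurable M" "f w \<in> borel_measurable M"
      using measurable_Pair2[OF f] zw by simp_all
    have "(\<integral>\<^sup>+x. f z x * f w x \<partial>M)\<^sup>2 \<le> (\<integral>\<^sup>+x. (f z x)\<^sup>2 \<partial>M) * (\<integral>\<^sup>+x. (f w x)\<^sup>2 \<partial>M)"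
      by (rule Cauchy_Schwarz_nn_integral) auto
    also have "\<dots> \<le> (g z)\<^sup>2 * (g w)\<^sup>2" by (intro mult_mono bd zw) auto
    finally have "(\<integral>\<^sup>+x. f z x * f w x \<partial>M)\<^sup>2 \<le> (g z * g w)\<^sup>2"
      by (simp add: power_mult_distrib)
    then show "(\<integral>\<^sup>+x. f z x * f w x \<partial>M) \<le> g z * g w"
      by (rule ennreal_power2_le_imp_le)
  qed
  also have "\<dots> = (\<integral>\<^sup>+z. g z \<partial>N)\<^sup>2"
    by (simp add: nn_integral_cmult nn_integral_multc power2_eq_square)
  finally show ?thesis .
qed

text \<open>Taylor's formula bounds the first-order remainder of exp (i z) by z^2/2. With z = 2 pi
  (y - x) \<xi> the remainder of the transform is at most M (y - x)^2, where M is 2 pi^2 times the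
  second absolute moment of \<open>g\<close>; hence the difference quotient converges.\<close>

lemma inverse_fourier_has_vector_derivative:
  fixes g :: "real \<Rightarrow> complex"
  assumes g[measurable]: "g \<in> borel_measurable borel"
    and int: "integrable lborel (\<lambda>\<xi>. norm (g \<xi>))" "integrable lborel (\<lambda>\<xi>. \<bar>\<xi>\<bar> * norm (g \<xi>))" "integrable lborel (\<lambda>\<xi>. \<xi>\<^sup>2 * norm (g \<xi>))"
  shows "(inverse_fourier g has_vector_derivative inverse_fourier (\<lambda>\<xi>. 2 * \<i> * of_real pi * of_real \<xi> * g \<xi>) x) (at x)"
proof -
  let ?e = "\<lambda>x \<xi>. exp (2 * \<i> * of_real pi * of_real x * of_real \<xi>) :: complex"
  let ?D = "inverse_fourier (\<lambda>\<xi>. 2 * \<i> * of_real pi * of_real \<xi> * g \<xi>) x"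
  define M where "M = (LINT \<xi>|lborel. 2 * pi\<^sup>2 * (\<xi>\<^sup>2 * norm (g \<xi>)))"
  have i0: "integrable lborel (\<lambda>\<xi>. ?e x \<xi> * g \<xi>)" for x
    by (rule Bochner_Integration.integrable_bound[OF int(1)]) (auto simp: norm_mult)
  have i1: "integrable lborel (\<lambda>\<xi>. ?e x \<xi> * (2 * \<i> * of_real pi * of_real \<xi> * g \<xi>))" for x
    by (rule Bochner_Integration.integrable_bound[OF integrable_mult_right[OF int(2), of "2 * pi"]]) (auto simp: norm_mult)
  have i2: "integrable lborel (\<lambda>\<xi>. 2 * pi\<^sup>2 * (\<xi>\<^sup>2 * norm (g \<xi>)))" using int(3) by simp
  have lin: "(LINT \<xi>|lborel. p \<xi> - q \<xi> - r *\<^sub>R s \<xi>)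
      = (LINT \<xi>|lborel. p \<xi>) - (LINT \<xi>|lborel. q \<xi>) - r *\<^sub>R (LINT \<xi>|lborel. s \<xi>)"
    if "integrable lborel p" "integrable lborel q" "integrable lborel s" for p q s :: "real \<Rightarrow> complex" and r
    using that by simp
  have bd: "norm (inverse_fourier g y - inverse_fourier g x - (y - x) *\<^sub>R ?D) \<le> M * (y - x)\<^sup>2" for y
  proof -
    have eq: "inverse_fourier g y - inverse_fourier g x - (y - x) *\<^sub>R ?D
        = (LINT \<xi>|lborel. ?e y \<xi> * g \<xi> - ?e x \<xi> * g \<xi> - (y - x) *\<^sub>R (?e x \<xi> * (2 * \<i> * of_real pi * of_real \<xi> * g \<xi>)))"
      unfolding inverse_fourier_def by (rule lin[OF i0 i0 i1, symmetric])
    have "norm (inverse_fourier g y - inverse_fourier g x - (y - x) *\<^sub>R ?D)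
        \<le> (LINT \<xi>|lborel. (y - x)\<^sup>2 * (2 * pi\<^sup>2 * (\<xi>\<^sup>2 * norm (g \<xi>))))"
      unfolding eq
    proof (rule Bochner_Integration.integral_norm_bound_integral)
      fix \<xi> :: real
      let ?z = "2 * pi * (y - x) * \<xi>"
      have e: "?e y \<xi> = ?e x \<xi> * iexp ?z"
        unfolding exp_add[symmetric] by (rule arg_cong[where f=exp]) (simp add: algebra_simps)
      have "norm (?e y \<xi> * g \<xi> - ?e x \<xi> * g \<xi> - (y - x) *\<^sub>R (?e x \<xi> * (2 * \<i> * of_real pi * of_real \<xi> * g \<xi>)))
          = norm (?e x \<xi> * (iexp ?z - (\<Sum>k\<le>1. (\<i> * ?z) ^ k / fact k)) * g \<xi>)"
        unfolding e by (simp add: algebra_simps scaleR_conv_of_real)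
      also have "\<dots> = norm (iexp ?z - (\<Sum>k\<le>1. (\<i> * ?z) ^ k / fact k)) * norm (g \<xi>)"
        by (simp add: norm_mult)
      also have "\<dots> \<le> (\<bar>?z\<bar> ^ Suc 1 / fact (Suc 1)) * norm (g \<xi>)"
        by (intro mult_right_mono iexp_approx1) auto
      also have "\<dots> = (y - x)\<^sup>2 * (2 * pi\<^sup>2 * (\<xi>\<^sup>2 * norm (g \<xi>)))"
        by (simp add: power2_eq_square abs_mult)
      finally show "norm (?e y \<xi> * g \<xi> - ?e x \<xi> * g \<xi> - (y - x) *\<^sub>R (?e x \<xi> * (2 * \<i> * of_real pi * of_real \<xi> * g \<xi>)))
          \<le> (y - x)\<^sup>2 * (2 * pi\<^sup>2 * (\<xi>\<^sup>2 * norm (g \<xi>)))" .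
    next
      show "integrable lborel (\<lambda>\<xi>. (y - x)\<^sup>2 * (2 * pi\<^sup>2 * (\<xi>\<^sup>2 * norm (g \<xi>))))"
        by (rule integrable_mult_right) (rule i2)
      show "integrable lborel (\<lambda>\<xi>. ?e y \<xi> * g \<xi> - ?e x \<xi> * g \<xi> - (y - x) *\<^sub>R (?e x \<xi> * (2 * \<i> * of_real pi * of_real \<xi> * g \<xi>)))"
        by (rule Bochner_Integration.integrable_diff[OF Bochner_Integration.integrable_diff[OF i0 i0] integrable_scaleR_right[OF i1]])
    qed
    also have "\<dots> = M * (y - x)\<^sup>2" unfolding M_def by (subst integral_mult_right_zero) (rule mult.commute)
    finally show ?thesis .
  qed
  show ?thesis
    unfolding has_vector_derivative_def has_derivative_at_within
  proof (intro conjI bounded_linear_scaleR_left)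
    have "((\<lambda>y. M * \<bar>y - x\<bar>) \<longlongrightarrow> M * \<bar>x - x\<bar>) (at x)"
      by (intro tendsto_intros)
    then have lim: "((\<lambda>y. M * \<bar>y - x\<bar>) \<longlongrightarrow> 0) (at x)" by simp
    show "((\<lambda>y. (inverse_fourier g y - inverse_fourier g x - (y - x) *\<^sub>R ?D) /\<^sub>R norm (y - x)) \<longlongrightarrow> 0) (at x)"
    proof (rule Lim_null_comparison[OF _ lim], rule eventually_at_ball'[THEN eventually_mono, of 1])
      fix y assume "y \<in> ball x 1 \<and> y \<noteq> x \<and> y \<in> UNIV"
      then have "y \<noteq> x" by simp
      then have pos: "0 < \<bar>y - x\<bar>" by simp
      have "(y - x)\<^sup>2 = \<bar>y - x\<bar> * \<bar>y - x\<bar>" by (simp add: power2_eq_square)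
      then have "norm (inverse_fourier g y - inverse_fourier g x - (y - x) *\<^sub>R ?D) \<le> (M * \<bar>y - x\<bar>) * \<bar>y - x\<bar>"
        using bd[of y] by (simp only: mult.assoc)
      then have "norm (inverse_fourier g y - inverse_fourier g x - (y - x) *\<^sub>R ?D) / \<bar>y - x\<bar> \<le> M * \<bar>y - x\<bar>"
        by (simp only: pos_divide_le_eq[OF pos])
      then show "norm ((inverse_fourier g y - inverse_fourier g x - (y - x) *\<^sub>R ?D) /\<^sub>R norm (y - x)) \<le> M * \<bar>y - x\<bar>"
        by (simp only: norm_scaleR real_norm_def abs_inverse abs_idempotent divide_inverse mult.commute)
    qed simp
  qed
qed

section \<open>The symbol\<close>

text \<open>As \<open>root 3\<close> is odd, \<open>x * root 3 x\<close> is |x|^(4/3). At 0 the cube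
  root itself has no derivative, but in Caratheodory's form the difference quotient of the product
  there is \<open>root 3\<close>, which is continuous.\<close>

lemma has_real_derivative_root3_pow4:
  "((\<lambda>x. x * root 3 x) has_real_derivative 4 / 3 * root 3 x) (at x)"
proof (cases "x = 0")
  case True
  show ?thesis
    unfolding CARAT_DERIV using True by (intro exI[of _ "root 3"]) (auto intro!: isCont_real_root)
next
  case False
  have r: "root 3 x ^ 3 = x" by (simp add: odd_real_root_pow)
  have "(root 3 has_real_derivative inverse (real 3 * root 3 x ^ (3 - Suc 0))) (at x)"
    using False by (intro DERIV_real_root_generic) auto
  then have "(root 3 has_real_derivative inverse (3 * root 3 x ^ 2)) (at x)"
    by simp
  note d = DERIV_mult[OF DERIV_ident this]
  have "1 * root 3 x + inverse (3 * root 3 x ^ 2) * x = 4 / 3 * root 3 x"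
    using False by (subst (3) r[symmetric]) (simp add: field_simps eval_nat_numeral)
  with d show ?thesis by simp
qed

text \<open>The odd companion x |x|^(1/3), from the imaginary part of the symbol. Away from 0 it
  agrees locally with plus or minus the even function already differentiated.\<close>

lemma has_real_derivative_root3_odd_pow4:
  "((\<lambda>x. x * \<bar>root 3 x\<bar>) has_real_derivative 4 / 3 * \<bar>root 3 x\<bar>) (at x)"
proof -
  consider "x = 0" | "x > 0" | "x < 0" by linarith
  then show ?thesis
  proof cases
    case 1
    then show ?thesis
      unfolding CARAT_DERIV by (intro exI[of _ "\<lambda>x. \<bar>root 3 x\<bar>"]) (auto intro!: isCont_real_root continuous_intros)
  next
    case 2
    have "((\<lambda>x. x * root 3 x) has_real_derivative 4 / 3 * \<bar>root 3 x\<bar>) (at x)"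
      using has_real_derivative_root3_pow4[of x] 2 by simp
    moreover have "eventually (\<lambda>y. y > 0) (nhds x)"
      using eventually_nhds_in_open[of "{0<..}" x] 2 by simp
    ultimately show ?thesis
      by (subst DERIV_cong_ev[OF refl _ refl, of _ "\<lambda>x. x * root 3 x"]) (auto elim: eventually_mono)
  next
    case 3
    have "((\<lambda>x. - (x * root 3 x)) has_real_derivative 4 / 3 * \<bar>root 3 x\<bar>) (at x)"
      using DERIV_minus[OF has_real_derivative_root3_pow4[of x]] 3 by simp
    moreover have "eventually (\<lambda>y. y < 0) (nhds x)"
      using eventually_nhds_in_open[of "{..<0}" x] 3 by simp
    ultimately show ?thesis
      by (subst DERIV_cong_ev[OF refl _ refl, of _ "\<lambda>x. - (x * root 3 x)"]) (auto elim: eventually_mono)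
  qed
qed

lemma abs_powr_third: "\<bar>x\<bar> powr (1 / 3) = \<bar>root 3 x\<bar>" for x :: real
proof (cases "x = 0")
  case False
  have "\<bar>x\<bar> powr (1 / 3) = root 3 \<bar>x\<bar>"
    using False root_powr_inverse[of 3 "\<bar>x\<bar>"] by simp
  then show ?thesis by (simp add: real_root_abs)
qed simp

lemma abs_powr_four_thirds: "\<bar>x\<bar> powr (4 / 3) = x * root 3 x" for x :: real
proof (cases "x = 0")
  case False
  have "\<bar>x\<bar> powr (4 / 3) = \<bar>x\<bar> powr (1 + 1 / 3)" by simp
  also have "\<dots> = \<bar>x\<bar> * \<bar>root 3 x\<bar>" unfolding powr_add abs_powr_third using False by simp
  also have "\<dots> = x * root 3 x" by (cases "x > 0") (auto simp: abs_if not_less)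
  finally show ?thesis .
qed simp

text \<open>Positivity of \<open>a\<close> is the source of the instability: near \<xi> = 0 the term
  - a |\<xi>|^(4/3) dominates 4 pi^2 \<xi>^2, so the real part of the symbol is negative at low
  nonzero frequencies.\<close>

locale fowler =
  fixes a b u :: real
  assumes a_pos: "0 < a"
begin

abbreviation \<phi> :: "real \<Rightarrow> complex" where "\<phi> \<equiv> fowler_phi a b u"

definition d\<phi> :: "real \<Rightarrow> complex" where
  "d\<phi> \<xi> = of_real (8 * pi\<^sup>2 * \<xi> - a * (4 / 3 * root 3 \<xi>))
    + \<i> * of_real (b * (4 / 3 * \<bar>root 3 \<xi>\<bar>) + 2 * pi * u)"

lemma \<phi>_eq: "\<phi> \<xi> = of_real (4 * pi\<^sup>2 * \<xi>\<^sup>2 - a * (\<xi> * root 3 \<xi>))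
    + \<i> * of_real (b * (\<xi> * \<bar>root 3 \<xi>\<bar>) + 2 * pi * u * \<xi>)"
  unfolding fowler_phi_def fowler_psi_def abs_powr_four_thirds abs_powr_third
  by (simp add: algebra_simps)

lemma Re_\<phi>: "Re (\<phi> \<xi>) = 4 * pi\<^sup>2 * \<xi>\<^sup>2 - a * (\<xi> * root 3 \<xi>)"
  by (simp add: \<phi>_eq)

lemma \<phi>_minus: "\<phi> (- \<xi>) = cnj (\<phi> \<xi>)"
  by (simp add: \<phi>_eq complex_eq_iff real_root_minus)

lemma \<phi>_has_derivative: "(\<phi> has_vector_derivative d\<phi> \<xi>) (at \<xi>)"
proof -
  have re: "((\<lambda>\<xi>. 4 * pi\<^sup>2 * \<xi>\<^sup>2 - a * (\<xi> * root 3 \<xi>)) has_real_derivative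
      8 * pi\<^sup>2 * \<xi> - a * (4 / 3 * root 3 \<xi>)) (at \<xi>)"
    by (rule derivative_eq_intros has_real_derivative_root3_pow4 refl | simp)+
  have im: "((\<lambda>\<xi>. b * (\<xi> * \<bar>root 3 \<xi>\<bar>) + 2 * pi * u * \<xi>) has_real_derivative
      b * (4 / 3 * \<bar>root 3 \<xi>\<bar>) + 2 * pi * u) (at \<xi>)"
    by (rule derivative_eq_intros has_real_derivative_root3_odd_pow4 refl | simp)+
  show ?thesis
    unfolding \<phi>_eq[abs_def] d\<phi>_def
    by (intro has_vector_derivative_add has_vector_derivative_mult_right has_vector_derivative_of_real)
      (use re im in \<open>simp_all add: has_real_derivative_iff_has_vector_derivative\<close>)
qed

lemma isCont_d\<phi>: "isCont d\<phi> \<xi>"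
  unfolding d\<phi>_def[abs_def] by (intro continuous_intros isCont_real_root)

lemma isCont_\<phi>: "isCont \<phi> \<xi>"
  using \<phi>_has_derivative by (rule has_vector_derivative_continuous)

lemma \<phi>_measurable[measurable]: "\<phi> \<in> borel_measurable borel"
  by (intro borel_measurable_continuous_onI) (simp add: continuous_on_eq_continuous_at isCont_\<phi>)

definition c\<phi> :: real where "c\<phi> = 8 * pi\<^sup>2 + 2 * a + 2 * \<bar>b\<bar> + 2 * pi * \<bar>u\<bar>"

lemma c\<phi>_pos: "0 < c\<phi>"
  unfolding c\<phi>_def using a_pos by (simp add: add_pos_nonneg)

text \<open>Linear growth is all that the Gaussian estimates have to absorb, so |\<xi>|^(1/3) is
  bounded by 1 + |\<xi>| and 4/3 is rounded up to 2; this explains the coefficients in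
  \<open>c\<phi>\<close>.\<close>

lemma norm_d\<phi>_le: "norm (d\<phi> \<xi>) \<le> c\<phi> * (1 + \<bar>\<xi>\<bar>)"
proof -
  define r where "r = \<bar>root 3 \<xi>\<bar>"
  have r0: "r \<ge> 0" by (simp add: r_def)
  have "r ^ 3 = \<bar>\<xi>\<bar>"
    unfolding r_def power_abs[symmetric] by (simp add: odd_real_root_pow)
  moreover have "r \<le> 1 + r ^ 3"
  proof (cases "r \<le> 1")
    case False
    then have "r ^ 1 \<le> r ^ 3" by (intro power_increasing) auto
    then show ?thesis by simp
  qed (use r0 in \<open>simp add: add_increasing2\<close>)
  ultimately have r: "r \<le> 1 + \<bar>\<xi>\<bar>" by simp
  have "norm (d\<phi> \<xi>) \<le> \<bar>8 * pi\<^sup>2 * \<xi> - a * (4 / 3 * root 3 \<xi>)\<bar> + \<bar>b * (4 / 3 * r) + 2 * pi * u\<bar>"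
    unfolding d\<phi>_def r_def[symmetric]
    by (rule order_trans[OF norm_triangle_ineq]) (simp only: norm_mult norm_of_real norm_ii mult_1_left order_refl)
  also have "\<dots> \<le> (8 * pi\<^sup>2 * \<bar>\<xi>\<bar> + a * (4 / 3 * r)) + (\<bar>b\<bar> * (4 / 3 * r) + 2 * pi * \<bar>u\<bar>)"
    using a_pos r0 by (intro add_mono order_trans[OF abs_triangle_ineq4] order_trans[OF abs_triangle_ineq])
      (simp_all add: abs_mult r_def)
  also have "\<dots> \<le> (8 * pi\<^sup>2 * (1 + \<bar>\<xi>\<bar>) + a * (2 * (1 + \<bar>\<xi>\<bar>))) + (\<bar>b\<bar> * (2 * (1 + \<bar>\<xi>\<bar>)) + 2 * pi * \<bar>u\<bar> * (1 + \<bar>\<xi>\<bar>))"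
    using a_pos r0 r by (intro add_mono mult_left_mono mult_right_mono) (simp_all add: distrib_left)
  also have "\<dots> = c\<phi> * (1 + \<bar>\<xi>\<bar>)" by (simp add: c\<phi>_def algebra_simps)
  finally show ?thesis .
qed

text \<open>In the variable s = |\<xi>|^(2/3), minus the real part of the symbol is a s^2 - 4 pi^2
  s^3. Over s >= 0 it is largest at s = a / (6 pi^2), with this value; \<open>\<xi>max\<close> is
  s^(3/2) at that point.\<close>

definition \<Lambda> :: real where "\<Lambda> = a ^ 3 / (108 * pi ^ 4)"

definition \<xi>max :: real where "\<xi>max = sqrt (a / (6 * pi\<^sup>2)) ^ 3"

lemma \<Lambda>_pos: "0 < \<Lambda>" using a_pos by (simp add: \<Lambda>_def)

lemma \<xi>max_pos: "0 < \<xi>max" using a_pos by (simp add: \<xi>max_def)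

text \<open>With \<open>s = \<bar>\<xi>\<bar>\<^bsup>2/3\<^esup>\<close> the claim reads \<open>a s\<^sup>2 - 4 \<pi>\<^sup>2 r s\<^sup>3 \<le> \<Lambda> / r\<^sup>2\<close>; the difference
  has a double root at the maximiser \<open>s = a / (6 \<pi>\<^sup>2 r)\<close>.\<close>
lemma Re_\<phi>_ge:
  assumes "0 < r"
  shows "4 * pi\<^sup>2 * (1 - r) * \<xi>\<^sup>2 - \<Lambda> / r\<^sup>2 \<le> Re (\<phi> \<xi>)"
proof -
  define s where "s = (root 3 \<xi>)\<^sup>2"
  define m where "m = a / (6 * pi\<^sup>2 * r)"
  have \<xi>: "\<xi> = root 3 \<xi> ^ 3" by (simp add: odd_real_root_pow)
  have x2: "\<xi>\<^sup>2 = s ^ 3" unfolding s_def by (subst \<xi>) (simp flip: power_mult)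
  have xr: "\<xi> * root 3 \<xi> = s\<^sup>2" unfolding s_def by (subst \<xi>) (simp add: eval_nat_numeral)
  have am: "a = 6 * pi\<^sup>2 * r * m" using assms by (simp add: m_def)
  have lm: "\<Lambda> / r\<^sup>2 = 2 * pi\<^sup>2 * r * m ^ 3"
    unfolding \<Lambda>_def by (subst am) (use assms in \<open>simp add: field_simps eval_nat_numeral\<close>)
  have "0 \<le> 4 * pi\<^sup>2 * r * ((s - m)\<^sup>2 * (s + m / 2))"
    using assms a_pos by (intro mult_nonneg_nonneg add_nonneg_nonneg) (auto simp: s_def m_def)
  also have "\<dots> = 4 * pi\<^sup>2 * r * s ^ 3 - a * s\<^sup>2 + \<Lambda> / r\<^sup>2"
    unfolding lm by (subst am) (simp add: field_simps eval_nat_numeral)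
  finally show ?thesis unfolding Re_\<phi> xr x2 by (simp add: algebra_simps)
qed

lemma Re_\<phi>_\<xi>max: "Re (\<phi> \<xi>max) = - \<Lambda>"
proof -
  define m where "m = a / (6 * pi\<^sup>2)"
  have m: "m > 0" using a_pos by (simp add: m_def)
  have am: "a = 6 * pi\<^sup>2 * m" by (simp add: m_def)
  have x: "\<xi>max = sqrt m ^ 3" by (simp add: \<xi>max_def m_def)
  have r: "root 3 \<xi>max = sqrt m" unfolding x using m by (simp add: real_root_power_cancel)
  have q: "sqrt m ^ 4 = m\<^sup>2" "sqrt m ^ 6 = m ^ 3"
    using m power_mult[of "sqrt m" 2 2] power_mult[of "sqrt m" 2 3] by simp_all
  have "\<xi>max\<^sup>2 = m ^ 3" unfolding x using q by (simp flip: power_mult)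
  moreover have "\<xi>max * root 3 \<xi>max = m\<^sup>2" unfolding r using q by (simp add: x eval_nat_numeral ac_simps)
  ultimately show ?thesis unfolding Re_\<phi> \<Lambda>_def by (simp add: am field_simps eval_nat_numeral)
qed

definition E :: "real \<Rightarrow> real \<Rightarrow> complex" where
  "E t \<xi> = exp (- (of_real t * \<phi> \<xi>))"

text \<open>Trades growth rate for decay in \<xi>. The choice r = 9/10 leaves the quadratic
  coefficient 4 pi^2 / 10 >= 3 and raises the rate by the factor 1 / 0.81 <= 5/4.\<close>

lemma Re_\<phi>_ge': "3 * \<xi>\<^sup>2 - 5 / 4 * \<Lambda> \<le> Re (\<phi> \<xi>)"
proof -
  have "3\<^sup>2 \<le> pi\<^sup>2" using pi_gt3 by (intro power_mono) auto
  then have "3 * \<xi>\<^sup>2 \<le> 4 * pi\<^sup>2 * (1 - 9 / 10) * \<xi>\<^sup>2"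
    by (intro mult_right_mono) auto
  moreover have "\<Lambda> / (9 / 10)\<^sup>2 \<le> 5 / 4 * \<Lambda>"
    using \<Lambda>_pos by (simp add: power2_eq_square)
  ultimately show ?thesis using Re_\<phi>_ge[of "9 / 10" \<xi>] by simp
qed

lemma norm_E_le:
  assumes "0 \<le> t"
  shows "norm (E t \<xi>) \<le> exp (5 / 4 * \<Lambda> * t) * exp (- (3 * t * \<xi>\<^sup>2))"
proof -
  have "t * (3 * \<xi>\<^sup>2 - 5 / 4 * \<Lambda>) \<le> t * Re (\<phi> \<xi>)"
    using Re_\<phi>_ge' assms by (rule mult_left_mono)
  then show ?thesis
    unfolding E_def by (simp add: algebra_simps flip: exp_add)
qed

lemma E_measurable[measurable]: "case_prod E \<in> borel_measurable (borel \<Otimes>\<^sub>M borel)"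
  unfolding E_def[abs_def] by measurable

lemma E_has_derivative: "(E t has_vector_derivative - (of_real t * d\<phi> \<xi> * E t \<xi>)) (at \<xi>)"
proof -
  have "((\<lambda>\<xi>. - (of_real t * \<phi> \<xi>)) has_vector_derivative - (of_real t * d\<phi> \<xi>)) (at \<xi>)"
    by (intro has_vector_derivative_minus has_vector_derivative_mult_right \<phi>_has_derivative)
  from field_vector_diff_chain_at[OF this DERIV_exp]
  show ?thesis by (simp add: o_def E_def[abs_def])
qed

lemma isCont_E: "isCont (E t) \<xi>"
  using E_has_derivative by (rule has_vector_derivative_continuous)

end

section \<open>The derivative of the kernel\<close>

lemma le_exp: "x \<le> exp x" for x :: real
  using exp_ge_add_one_self[of x] by linarith

lemma abs_le_exp_square: "\<bar>x\<bar> \<le> exp (x\<^sup>2)" for x :: real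
proof -
  have "0 \<le> (\<bar>x\<bar> - 1)\<^sup>2" by simp
  then have "2 * \<bar>x\<bar> \<le> 1 + x\<^sup>2" by (simp add: power2_diff)
  then have "\<bar>x\<bar> \<le> 1 + x\<^sup>2" using zero_le_power2[of x] abs_ge_zero[of x] by linarith
  also have "\<dots> \<le> exp (x\<^sup>2)" by (rule exp_ge_add_one_self)
  finally show ?thesis .
qed

lemma continuous_measurable_borel: "(\<And>x. isCont f x) \<Longrightarrow> f \<in> borel_measurable borel"
  for f :: "real \<Rightarrow> complex"
  by (intro borel_measurable_continuous_onI) (simp add: continuous_on_eq_continuous_at)

context fowler
begin

lemma E_measurable'[measurable]: "E t \<in> borel_measurable borel"
  by (rule continuous_measurable_borel) (rule isCont_E)

text \<open>The Gaussian exp (- 3 t \<xi>^2) is split: the factor exp (- t \<xi>^2) absorbs the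
  polynomial weight and exp (- 2 t \<xi>^2) remains integrable. The second moment is what
  differentiating the kernel requires.\<close>

lemma integrable_E_moments:
  assumes t: "0 < t"
  shows "integrable lborel (\<lambda>\<xi>. norm (E t \<xi>))" "integrable lborel (\<lambda>\<xi>. \<bar>\<xi>\<bar> * norm (E t \<xi>))"
    "integrable lborel (\<lambda>\<xi>. \<xi>\<^sup>2 * norm (E t \<xi>))"
proof -
  let ?c = "exp (5 / 4 * \<Lambda> * t)"
  have G: "integrable lborel (\<lambda>\<xi>. c * exp (- (2 * t) * \<xi>\<^sup>2))" for c
    using gaussian_integrable[of "2 * t"] t by simp
  have e: "exp (- (3 * t * \<xi>\<^sup>2)) = exp (- (t * \<xi>\<^sup>2)) * exp (- (2 * t) * \<xi>\<^sup>2)" for \<xi>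
    by (simp flip: exp_add)
  have b0: "norm (E t \<xi>) \<le> ?c * exp (- (2 * t) * \<xi>\<^sup>2)" for \<xi>
  proof -
    have "exp (- (3 * t * \<xi>\<^sup>2)) \<le> exp (- (2 * t) * \<xi>\<^sup>2)" using t by simp
    then show ?thesis using norm_E_le[of t \<xi>] t by (meson exp_ge_zero less_eq_real_def mult_left_mono order_trans)
  qed
  have b2: "\<xi>\<^sup>2 * norm (E t \<xi>) \<le> ?c / t * exp (- (2 * t) * \<xi>\<^sup>2)" for \<xi>
  proof -
    have "t * \<xi>\<^sup>2 * exp (- (t * \<xi>\<^sup>2)) \<le> exp (t * \<xi>\<^sup>2) * exp (- (t * \<xi>\<^sup>2))"
      by (intro mult_right_mono le_exp) auto
    also have "\<dots> = 1" by (simp flip: exp_add)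
    finally have *: "\<xi>\<^sup>2 * exp (- (t * \<xi>\<^sup>2)) \<le> 1 / t" using t by (simp add: field_simps)
    have "\<xi>\<^sup>2 * norm (E t \<xi>) \<le> \<xi>\<^sup>2 * (?c * exp (- (3 * t * \<xi>\<^sup>2)))"
      using t by (intro mult_left_mono norm_E_le) auto
    also have "\<dots> = ?c * exp (- (2 * t) * \<xi>\<^sup>2) * (\<xi>\<^sup>2 * exp (- (t * \<xi>\<^sup>2)))"
      unfolding e by (simp only: ac_simps)
    also have "\<dots> \<le> ?c * exp (- (2 * t) * \<xi>\<^sup>2) * (1 / t)"
      by (intro mult_left_mono *) auto
    finally show ?thesis by simp
  qed
  have b1: "\<bar>\<xi>\<bar> * norm (E t \<xi>) \<le> (?c + ?c / t) * exp (- (2 * t) * \<xi>\<^sup>2)" for \<xi>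
  proof -
    have "0 \<le> (\<bar>\<xi>\<bar> - 1)\<^sup>2" by simp
    then have "2 * \<bar>\<xi>\<bar> \<le> 1 + \<xi>\<^sup>2" by (simp add: power2_diff)
    then have "\<bar>\<xi>\<bar> \<le> 1 + \<xi>\<^sup>2" using zero_le_power2[of \<xi>] abs_ge_zero[of \<xi>] by linarith
    then have "\<bar>\<xi>\<bar> * norm (E t \<xi>) \<le> (1 + \<xi>\<^sup>2) * norm (E t \<xi>)" by (rule mult_right_mono) simp
    then show ?thesis using b0[of \<xi>] b2[of \<xi>] by (simp only: distrib_right)
  qed
  show "integrable lborel (\<lambda>\<xi>. norm (E t \<xi>))"
    by (rule Bochner_Integration.integrable_bound[OF G]) (use b0 in \<open>auto intro!: AE_I2 order_trans[OF _ abs_ge_self]\<close>)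
  show "integrable lborel (\<lambda>\<xi>. \<bar>\<xi>\<bar> * norm (E t \<xi>))"
    by (rule Bochner_Integration.integrable_bound[OF G[of "?c + ?c / t"]], measurable, rule AE_I2,
      insert order_trans[OF b1 abs_ge_self], simp only: real_norm_def abs_mult abs_idempotent abs_norm_cancel)
  show "integrable lborel (\<lambda>\<xi>. \<xi>\<^sup>2 * norm (E t \<xi>))"
    by (rule Bochner_Integration.integrable_bound[OF G[of "?c / t"]]) (use b2 t in \<open>auto intro!: AE_I2 order_trans[OF _ abs_ge_self]\<close>)
qed

lemma fowler_kernel_eq: "fowler_kernel a b u t = inverse_fourier (E t)"
  by (simp add: fowler_kernel_def E_def[abs_def])

definition D :: "real \<Rightarrow> real \<Rightarrow> complex" where
  "D t = inverse_fourier (\<lambda>\<xi>. 2 * \<i> * of_real pi * of_real \<xi> * E t \<xi>)"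

lemma derivative_fowler_kernel: "0 < t \<Longrightarrow> derivative (fowler_kernel a b u t) = D t"
  unfolding derivative_def fowler_kernel_eq D_def
  by (intro ext vector_derivative_at inverse_fourier_has_vector_derivative integrable_E_moments E_measurable')

lemma D_measurable[measurable]: "case_prod D \<in> borel_measurable (borel \<Otimes>\<^sub>M borel)"
proof -
  have "(\<lambda>z. LINT \<xi>|lborel. exp (2 * \<i> * of_real pi * of_real (snd z) * of_real \<xi>) *
      (2 * \<i> * of_real pi * of_real \<xi> * E (fst z) \<xi>)) \<in> borel_measurable (borel \<Otimes>\<^sub>M borel)"
    by measurable
  then show ?thesis by (simp add: D_def inverse_fourier_def case_prod_beta')
qed

text \<open>The square root of the constant that comes out of \<open>D_L2_bound\<close>; the factor
  1 + 2 / \<Lambda> is the price of replacing 1 + t by exp (\<Lambda> t / 2).\<close>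

definition cD :: real where "cD = sqrt (2 * pi ^ 3 * (1 + 2 * c\<phi>) * (1 + 2 / \<Lambda>))"

lemma cD_pos: "0 < cD"
  unfolding cD_def using c\<phi>_pos \<Lambda>_pos
  by (intro real_sqrt_gt_zero mult_pos_pos add_pos_pos) auto

text \<open>The power -3/4 is the parabolic scaling of the L2 norm of the x-derivative of a heat
  kernel, and it is integrable at 0.\<close>

definition bD :: "real \<Rightarrow> real" where
  "bD t = cD * (t powr (- 3 / 4) * exp (3 / 2 * \<Lambda> * t))"

text \<open>\<open>inverse_fourier_L2_bound\<close> with Gaussian exponent 2 t. The factor |\<xi>|
  in \<open>h\<close> costs 1 / sqrt t, the derivative \<open>h'\<close> costs a multiple of 1 + t,
  and the exponent contributes 1 / (2 t); so the squared norm is of order (1 + t) t^(-3/2) exp (5/2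
  \<Lambda> t).\<close>

lemma D_L2_bound:
  assumes t: "0 < t"
  shows "(\<integral>\<^sup>+x. ennreal ((norm (D t x))\<^sup>2) \<partial>lborel) \<le> ennreal ((bD t)\<^sup>2)"
proof -
  let ?e = "exp (5 / 4 * \<Lambda> * t)"
  define h where "h \<xi> = 2 * \<i> * of_real pi * of_real \<xi> * E t \<xi>" for \<xi>
  define h' where "h' \<xi> = 2 * \<i> * of_real pi * ((1 - of_real (t * \<xi>) * d\<phi> \<xi>) * E t \<xi>)" for \<xi>
  have split: "exp (- (3 * t * \<xi>\<^sup>2)) = exp (- (t * \<xi>\<^sup>2)) * exp (- (2 * t) * (\<xi> - 0)\<^sup>2)" for \<xi>
    by (simp flip: exp_add)
  have cancel: "exp (t * \<xi>\<^sup>2) * exp (- (t * \<xi>\<^sup>2)) = 1" for \<xi> by (simp flip: exp_add)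
  have "(\<integral>\<^sup>+x. ennreal ((norm (inverse_fourier h x))\<^sup>2) \<partial>lborel)
      \<le> ennreal ((2 * pi / sqrt t * ?e) * (2 * pi * (1 + 2 * c\<phi>) * (1 + t) * ?e) * pi / (2 * t))"
  proof (rule inverse_fourier_L2_bound[where h' = h' and k = 0])
    show "(h has_vector_derivative h' \<xi>) (at \<xi>)" for \<xi>
    proof -
      have "((\<lambda>\<xi>. of_real \<xi> * E t \<xi>) has_vector_derivative
          of_real \<xi> * (- (of_real t * d\<phi> \<xi> * E t \<xi>)) + of_real 1 * E t \<xi>) (at \<xi>)"
        by (intro has_vector_derivative_mult E_has_derivative has_vector_derivative_of_real)
          (simp add: has_real_derivative_iff_has_vector_derivative[symmetric])
      from has_vector_derivative_mult_right[OF this, of "2 * \<i> * of_real pi"]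
      show ?thesis unfolding h_def[abs_def] h'_def by (simp add: algebra_simps)
    qed
    show "isCont h' \<xi>" for \<xi>
      unfolding h'_def[abs_def] by (intro continuous_intros isCont_d\<phi> isCont_E)
    show "norm (h \<xi>) \<le> (2 * pi / sqrt t * ?e) * exp (- (2 * t) * (\<xi> - 0)\<^sup>2)" for \<xi>
    proof -
      have "\<bar>sqrt t * \<xi>\<bar> \<le> exp ((sqrt t * \<xi>)\<^sup>2)" by (rule abs_le_exp_square)
      also have "(sqrt t * \<xi>)\<^sup>2 = t * \<xi>\<^sup>2" using t by (simp add: power_mult_distrib)
      finally have "\<bar>sqrt t * \<xi>\<bar> * exp (- (t * \<xi>\<^sup>2)) \<le> exp (t * \<xi>\<^sup>2) * exp (- (t * \<xi>\<^sup>2))"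
        by (rule mult_right_mono) simp
      then have *: "\<bar>\<xi>\<bar> * exp (- (t * \<xi>\<^sup>2)) \<le> 1 / sqrt t"
        unfolding cancel using t by (simp add: abs_mult field_simps)
      have "norm (h \<xi>) = 2 * pi * \<bar>\<xi>\<bar> * norm (E t \<xi>)"
        unfolding h_def by (simp add: norm_mult)
      also have "\<dots> \<le> 2 * pi * \<bar>\<xi>\<bar> * (?e * exp (- (3 * t * \<xi>\<^sup>2)))"
        using t by (intro mult_left_mono norm_E_le) auto
      also have "\<dots> = 2 * pi * ?e * exp (- (2 * t) * (\<xi> - 0)\<^sup>2) * (\<bar>\<xi>\<bar> * exp (- (t * \<xi>\<^sup>2)))"
        unfolding split by (simp only: ac_simps)
      also have "\<dots> \<le> 2 * pi * ?e * exp (- (2 * t) * (\<xi> - 0)\<^sup>2) * (1 / sqrt t)"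
        by (intro mult_left_mono *) auto
      finally show ?thesis by (simp add: ac_simps)
    qed
    show "norm (h' \<xi>) \<le> (2 * pi * (1 + 2 * c\<phi>) * (1 + t) * ?e) * exp (- (2 * t) * (\<xi> - 0)\<^sup>2)" for \<xi>
    proof -
      \<comment> \<open>This one exponential majorises both 1 and t \<xi>^2, and later cancels
        against the factor exp (- t \<xi>^2) split off the Gaussian.\<close>
      let ?y = "exp (t * \<xi>\<^sup>2)"
      have y1: "1 \<le> ?y" and y2: "t * \<xi>\<^sup>2 \<le> ?y" using t le_exp by auto
      have "0 \<le> (\<bar>\<xi>\<bar> - 1)\<^sup>2" by simp
      then have "2 * \<bar>\<xi>\<bar> \<le> 1 + \<xi>\<^sup>2" by (simp add: power2_diff)
      then have q: "\<bar>\<xi>\<bar> * (1 + \<bar>\<xi>\<bar>) \<le> 1 + 2 * \<xi>\<^sup>2"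
        using zero_le_power2[of \<xi>] by (simp add: distrib_left power2_eq_square)
      have "norm (1 - of_real (t * \<xi>) * d\<phi> \<xi>) \<le> 1 + t * \<bar>\<xi>\<bar> * norm (d\<phi> \<xi>)"
        by (rule order_trans[OF norm_triangle_ineq4]) (use t in \<open>simp add: norm_mult abs_mult\<close>)
      also have "\<dots> \<le> 1 + t * \<bar>\<xi>\<bar> * (c\<phi> * (1 + \<bar>\<xi>\<bar>))"
        using t by (intro add_mono mult_left_mono norm_d\<phi>_le) auto
      also have "\<dots> = 1 + c\<phi> * t * (\<bar>\<xi>\<bar> * (1 + \<bar>\<xi>\<bar>))" by (simp only: ac_simps)
      also have "\<dots> \<le> 1 + c\<phi> * t * (1 + 2 * \<xi>\<^sup>2)"
        using t c\<phi>_pos q by (intro add_mono mult_left_mono) auto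
      also have "\<dots> = 1 + c\<phi> * (t * 1 + 2 * (t * \<xi>\<^sup>2))" by (simp add: algebra_simps)
      also have "\<dots> \<le> 1 * ?y + c\<phi> * (t * ?y + 2 * ?y)"
        using t c\<phi>_pos y1 y2 by (intro add_mono mult_left_mono) auto
      also have "\<dots> \<le> (1 + 2 * c\<phi>) * (1 + t) * ?y"
        using t c\<phi>_pos y1 by (simp add: algebra_simps mult_nonneg_nonneg add_nonneg_nonneg)
      finally have *: "norm (1 - of_real (t * \<xi>) * d\<phi> \<xi>) \<le> (1 + 2 * c\<phi>) * (1 + t) * ?y" .
      have "norm (h' \<xi>) = 2 * pi * (norm (1 - of_real (t * \<xi>) * d\<phi> \<xi>) * norm (E t \<xi>))"
        unfolding h'_def by (simp only: norm_mult norm_of_real norm_ii norm_numeral) simp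
      also have "\<dots> \<le> 2 * pi * (((1 + 2 * c\<phi>) * (1 + t) * ?y) * (?e * exp (- (3 * t * \<xi>\<^sup>2))))"
        using t c\<phi>_pos by (intro mult_left_mono mult_mono * norm_E_le) auto
      also have "\<dots> = (2 * pi * (1 + 2 * c\<phi>) * (1 + t) * ?e) * exp (- (2 * t) * (\<xi> - 0)\<^sup>2) * (?y * exp (- (t * \<xi>\<^sup>2)))"
        unfolding split by (simp only: ac_simps)
      finally show ?thesis unfolding cancel by simp
    qed
  qed (use t c\<phi>_pos in \<open>auto intro!: mult_pos_pos add_pos_pos\<close>)
  also have "(2 * pi / sqrt t * ?e) * (2 * pi * (1 + 2 * c\<phi>) * (1 + t) * ?e) * pi / (2 * t)
      = 2 * pi ^ 3 * (1 + 2 * c\<phi>) * (1 + t) * (?e * ?e) * (1 / (t * sqrt t))"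
    using t by (simp add: field_simps eval_nat_numeral)
  also have "\<dots> \<le> 2 * pi ^ 3 * (1 + 2 * c\<phi>) * ((1 + 2 / \<Lambda>) * exp (\<Lambda> * t / 2)) * (?e * ?e) * (1 / (t * sqrt t))"
  proof (intro mult_right_mono mult_left_mono)
    \<comment> \<open>Absorbing 1 + t raises the rate of the squared norm from 5/2 \<Lambda> to 3
      \<Lambda>, hence 3/2 \<Lambda> in \<open>bD\<close>.\<close>
    have "1 + t \<le> (1 + 2 / \<Lambda>) * (1 + \<Lambda> * t / 2)"
      using t \<Lambda>_pos by (simp add: field_simps)
    also have "\<dots> \<le> (1 + 2 / \<Lambda>) * exp (\<Lambda> * t / 2)"
      using \<Lambda>_pos by (intro mult_left_mono exp_ge_add_one_self) auto
    finally show "1 + t \<le> (1 + 2 / \<Lambda>) * exp (\<Lambda> * t / 2)" .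
  qed (use t c\<phi>_pos in auto)
  also have "\<dots> = (2 * pi ^ 3 * (1 + 2 * c\<phi>) * (1 + 2 / \<Lambda>)) * (1 / (t * sqrt t)) * (exp (\<Lambda> * t / 2) * ?e * ?e)"
    by (simp only: ac_simps)
  also have "2 * pi ^ 3 * (1 + 2 * c\<phi>) * (1 + 2 / \<Lambda>) = cD\<^sup>2"
    unfolding cD_def using c\<phi>_pos \<Lambda>_pos by (subst real_sqrt_pow2) (auto intro!: mult_nonneg_nonneg add_nonneg_nonneg)
  also have "exp (\<Lambda> * t / 2) * ?e * ?e = (exp (3 / 2 * \<Lambda> * t))\<^sup>2"
    by (simp add: power2_eq_square flip: exp_add)
  also have "1 / (t * sqrt t) = (t powr (- 3 / 4))\<^sup>2"
  proof -
    have "t * sqrt t = t powr (3 / 2)" using t powr_mult_base[of t "1 / 2"] by (simp add: powr_half_sqrt)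
    moreover have "(t powr (- 3 / 4))\<^sup>2 = t powr (- (3 / 2))" by (simp add: power2_eq_square flip: powr_add)
    ultimately show ?thesis by (simp add: powr_minus_divide)
  qed
  also have "cD\<^sup>2 * (t powr (- 3 / 4))\<^sup>2 * (exp (3 / 2 * \<Lambda> * t))\<^sup>2 = (bD t)\<^sup>2"
    by (simp add: bD_def power_mult_distrib)
  finally show ?thesis by (simp add: D_def h_def[abs_def] ennreal_leI)
qed

end

section \<open>Linear evolution of wave packets\<close>

definition packet :: "real \<Rightarrow> real \<Rightarrow> real \<Rightarrow> complex" where
  "packet R k x = of_real (exp (- (pi / R\<^sup>2) * x\<^sup>2)) * exp (\<i> * of_real (2 * pi * k * x))"

text \<open>The Fourier transform of \<open>packet R k\<close>. It concentrates at \<open>k\<close>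
  on the scale 1/R, so for large R the multiplier \<open>E t\<close> acts on the packet almost as
  the number \<open>E t k\<close>.\<close>

definition packet_hat :: "real \<Rightarrow> real \<Rightarrow> real \<Rightarrow> real" where
  "packet_hat R k \<xi> = R * exp (- (pi * R\<^sup>2) * (\<xi> - k)\<^sup>2)"

lemma packet_eq_inverse_fourier:
  assumes R: "0 < R"
  shows "inverse_fourier (\<lambda>\<xi>. of_real (packet_hat R k \<xi>)) x = packet R k x"
proof -
  let ?f = "\<lambda>\<xi>. exp (2 * \<i> * of_real pi * of_real x * of_real \<xi>) * complex_of_real (packet_hat R k \<xi>)"
  have "inverse_fourier (\<lambda>\<xi>. of_real (packet_hat R k \<xi>)) x = (LINT \<xi>|lborel. ?f \<xi>)"
    by (simp add: inverse_fourier_def)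
  also have "\<dots> = (LINT \<xi>|lborel. ?f (k + 1 * \<xi>))"
    using lborel_integral_real_affine[of 1 ?f k] by simp
  also have "\<dots> = (LINT \<xi>|lborel. (of_real R * exp (\<i> * of_real (2 * pi * k * x)))
      * (exp (\<i> * of_real ((2 * pi * x) * \<xi>)) * of_real (exp (- (pi * R\<^sup>2) * \<xi>\<^sup>2))))"
    by (rule Bochner_Integration.integral_cong) (auto simp: packet_hat_def algebra_simps exp_add)
  also have "\<dots> = (of_real R * exp (\<i> * of_real (2 * pi * k * x)))
      * of_real (sqrt (pi / (pi * R\<^sup>2)) * exp (- ((2 * pi * x)\<^sup>2 / (4 * (pi * R\<^sup>2)))))"
    using R by (subst integral_mult_right_zero, subst gaussian_fourier) auto
  also have "sqrt (pi / (pi * R\<^sup>2)) = 1 / R"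
    using R by (simp add: real_sqrt_divide)
  also have "(2 * pi * x)\<^sup>2 / (4 * (pi * R\<^sup>2)) = (pi / R\<^sup>2) * x\<^sup>2"
    using R by (simp add: field_simps power2_eq_square)
  finally show ?thesis using R by (simp add: packet_def)
qed

lemma fourier_packet:
  assumes R: "0 < R"
  shows "(LINT y|lborel. exp (- (2 * \<i> * of_real pi * of_real y * of_real \<xi>)) * packet R k y)
    = of_real (packet_hat R k \<xi>)"
proof -
  have "(LINT y|lborel. exp (- (2 * \<i> * of_real pi * of_real y * of_real \<xi>)) * packet R k y)
    = (LINT y|lborel. exp (\<i> * of_real ((2 * pi * (k - \<xi>)) * y)) * of_real (exp (- (pi / R\<^sup>2) * y\<^sup>2)))"
    by (rule Bochner_Integration.integral_cong) (auto simp: packet_def algebra_simps simp flip: exp_add)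
  also have "\<dots> = of_real (sqrt (pi / (pi / R\<^sup>2)) * exp (- ((2 * pi * (k - \<xi>))\<^sup>2 / (4 * (pi / R\<^sup>2)))))"
    using R by (subst gaussian_fourier) auto
  also have "sqrt (pi / (pi / R\<^sup>2)) = R" using R by simp
  also have "(2 * pi * (k - \<xi>))\<^sup>2 / (4 * (pi / R\<^sup>2)) = (pi * R\<^sup>2) * (\<xi> - k)\<^sup>2"
    using R by (simp add: field_simps power2_eq_square)
  finally show ?thesis by (simp add: packet_hat_def)
qed

lemma norm_packet: "norm (packet R k x) = exp (- (pi / R\<^sup>2) * x\<^sup>2)"
  unfolding packet_def by (simp only: norm_mult norm_of_real norm_exp_i_times) simp

lemma packet_measurable[measurable]: "packet R k \<in> borel_measurable borel"
  unfolding packet_def[abs_def] by measurable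

lemma integrable_packet: "0 < R \<Longrightarrow> integrable lborel (packet R k)"
  by (rule Bochner_Integration.integrable_bound[OF gaussian_integrable[of "pi / R\<^sup>2"]]) (auto simp: norm_packet)

context fowler
begin

lemma integrable_kernel_packet:
  assumes "0 < t" "0 < R"
  shows "integrable lborel (\<lambda>y. fowler_kernel a b u t (x - y) * packet R k y)"
proof (rule Bochner_Integration.integrable_bound[OF integrable_mult_right[OF integrable_norm[OF integrable_packet[OF assms(2)]], of "LINT \<xi>|lborel. norm (E t \<xi>)"]])
  have "continuous_on UNIV (inverse_fourier (E t))"
    unfolding continuous_on_eq_continuous_at[OF open_UNIV]
    using inverse_fourier_has_vector_derivative[OF E_measurable' integrable_E_moments[OF assms(1)]]
    by (blast intro: has_vector_derivative_continuous)
  then have [measurable]: "inverse_fourier (E t) \<in> borel_measurable borel"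
    by (rule borel_measurable_continuous_onI)
  show "(\<lambda>y. fowler_kernel a b u t (x - y) * packet R k y) \<in> borel_measurable lborel"
    unfolding fowler_kernel_eq by measurable
  have "norm (inverse_fourier (E t) z) \<le> (LINT \<xi>|lborel. norm (E t \<xi>))" for z
    by (rule inverse_fourier_norm_le[OF integrable_E_moments(1)[OF assms(1)]]) auto
  then show "AE y in lborel. norm (fowler_kernel a b u t (x - y) * packet R k y)
      \<le> norm ((LINT \<xi>|lborel. norm (E t \<xi>)) * norm (packet R k y))"
    unfolding fowler_kernel_eq
    by (intro AE_I2) (auto simp: norm_mult abs_mult intro!: mult_right_mono order_trans[OF _ abs_ge_self])
qed

text \<open>The convolution theorem for this pair. The modulus of the double integrand is the
  product of |\<open>E t\<close>| in \<xi> and of the packet's Gaussian envelope in y, both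
  integrable, so Fubini applies and the integral over y is the transform of the packet.\<close>

lemma convolution_kernel_packet:
  assumes t: "0 < t" and R: "0 < R"
  shows "Defs.convolution (fowler_kernel a b u t) (packet R k) x
    = inverse_fourier (\<lambda>\<xi>. E t \<xi> * of_real (packet_hat R k \<xi>)) x"
proof -
  let ?F = "\<lambda>y \<xi>. exp (2 * \<i> * of_real pi * of_real (x - y) * of_real \<xi>) * E t \<xi> * packet R k y"
  have iE: "integrable lborel (\<lambda>\<xi>. norm (E t \<xi>))" by (rule integrable_E_moments(1)[OF t])
  have n: "norm (?F y \<xi>) = norm (E t \<xi>) * norm (packet R k y)" for y \<xi>
    by (simp add: norm_mult)
  have m[measurable]: "case_prod ?F \<in> borel_measurable (lborel \<Otimes>\<^sub>M lborel)" by measurable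
  have row: "integrable lborel (\<lambda>\<xi>. ?F y \<xi>)" for y
    by (rule Bochner_Integration.integrable_bound[OF integrable_mult_left[OF iE, of "norm (packet R k y)"]])
      (auto simp: norm_mult)
  have int: "integrable (lborel \<Otimes>\<^sub>M lborel) (case_prod ?F)"
  proof (rule lborel_pair.Fubini_integrable)
    show "integrable lborel (\<lambda>y. LINT \<xi>|lborel. norm (case (y, \<xi>) of (y, \<xi>) \<Rightarrow> ?F y \<xi>))"
      using integrable_norm[OF integrable_packet[OF R, of k]] by (simp only: prod.case n) simp
  qed (use row in auto)
  have "Defs.convolution (fowler_kernel a b u t) (packet R k) x = (LINT y|lborel. LINT \<xi>|lborel. ?F y \<xi>)"
    unfolding Defs.convolution_def fowler_kernel_eq inverse_fourier_def by simp
  also have "\<dots> = (LINT \<xi>|lborel. LINT y|lborel. ?F y \<xi>)"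
    by (rule lborel_pair.Fubini_integral[OF int, symmetric])
  also have "\<dots> = (LINT \<xi>|lborel. exp (2 * \<i> * of_real pi * of_real x * of_real \<xi>) * (E t \<xi> * of_real (packet_hat R k \<xi>)))"
  proof (rule Bochner_Integration.integral_cong[OF refl])
    fix \<xi>
    have "(LINT y|lborel. ?F y \<xi>) = (LINT y|lborel. (exp (2 * \<i> * of_real pi * of_real x * of_real \<xi>) * E t \<xi>)
        * (exp (- (2 * \<i> * of_real pi * of_real y * of_real \<xi>)) * packet R k y))"
      by (rule Bochner_Integration.integral_cong) (auto simp: algebra_simps exp_diff exp_minus field_simps)
    also have "\<dots> = exp (2 * \<i> * of_real pi * of_real x * of_real \<xi>) * E t \<xi> * of_real (packet_hat R k \<xi>)"
      by (subst integral_mult_right_zero, subst fourier_packet[OF R]) simp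
    finally show "(LINT y|lborel. ?F y \<xi>) = exp (2 * \<i> * of_real pi * of_real x * of_real \<xi>) * (E t \<xi> * of_real (packet_hat R k \<xi>))"
      by (simp only: mult.assoc)
  qed
  finally show ?thesis by (simp add: inverse_fourier_def)
qed

text \<open>The point is uniformity as t tends to 0, where the Gaussian decay of \<open>E t\<close>
  is lost. The derivative carries a factor t, and t \<xi>^2 exp (- 3 t \<xi>^2) <= 1 controls its
  linear growth in \<xi> for all times up to T.\<close>

lemma E_lipschitz:
  assumes T: "0 < T"
  obtains L where "0 < L" "\<And>t \<xi>. 0 < t \<Longrightarrow> t \<le> T \<Longrightarrow> norm (of_real t * d\<phi> \<xi> * E t \<xi>) \<le> L"
    "\<And>t \<xi> k. 0 < t \<Longrightarrow> t \<le> T \<Longrightarrow> norm (E t \<xi> - E t k) \<le> L * \<bar>\<xi> - k\<bar>"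
proof -
  define L where "L = c\<phi> * (2 * T + 1) * exp (5 / 4 * \<Lambda> * T)"
  have L: "0 < L" using T c\<phi>_pos by (simp add: L_def)
  have d: "norm (of_real t * d\<phi> \<xi> * E t \<xi>) \<le> L" if t: "0 < t" "t \<le> T" for t \<xi>
  proof -
    let ?y = "exp (- (3 * t * \<xi>\<^sup>2))"
    have y: "0 \<le> ?y" "?y \<le> 1" using t by auto
    have "t * \<xi>\<^sup>2 * ?y \<le> exp (t * \<xi>\<^sup>2) * ?y" by (intro mult_right_mono le_exp) auto
    also have "\<dots> \<le> 1" using t by (simp flip: exp_add)
    finally have z: "t * \<xi>\<^sup>2 * ?y \<le> 1" .
    have "0 \<le> (\<bar>\<xi>\<bar> - 1)\<^sup>2" by simp
    then have "2 * \<bar>\<xi>\<bar> \<le> 1 + \<xi>\<^sup>2" by (simp add: power2_diff)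
    then have q: "1 + \<bar>\<xi>\<bar> \<le> 2 + \<xi>\<^sup>2" using zero_le_power2[of \<xi>] abs_ge_zero[of \<xi>] by linarith
    have "t * (1 + \<bar>\<xi>\<bar>) * ?y \<le> t * (2 + \<xi>\<^sup>2) * ?y"
      using t q by (intro mult_left_mono mult_right_mono) auto
    also have "\<dots> = 2 * t * ?y + t * \<xi>\<^sup>2 * ?y" by (simp add: algebra_simps)
    also have "\<dots> \<le> 2 * T * 1 + 1" using t y z by (intro add_mono mult_mono) auto
    finally have w: "t * (1 + \<bar>\<xi>\<bar>) * ?y \<le> 2 * T + 1" by simp
    have "norm (of_real t * d\<phi> \<xi> * E t \<xi>) = t * norm (d\<phi> \<xi>) * norm (E t \<xi>)"
      using t by (simp add: norm_mult)
    also have "\<dots> \<le> t * (c\<phi> * (1 + \<bar>\<xi>\<bar>)) * (exp (5 / 4 * \<Lambda> * t) * ?y)"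
      using t c\<phi>_pos by (intro mult_mono mult_left_mono norm_d\<phi>_le norm_E_le) auto
    also have "\<dots> = c\<phi> * (t * (1 + \<bar>\<xi>\<bar>) * ?y) * exp (5 / 4 * \<Lambda> * t)" by (simp only: ac_simps)
    also have "\<dots> \<le> c\<phi> * (2 * T + 1) * exp (5 / 4 * \<Lambda> * T)"
      using t T c\<phi>_pos w \<Lambda>_pos by (intro mult_mono mult_left_mono) auto
    finally show ?thesis by (simp add: L_def)
  qed
  have "norm (E t \<xi> - E t k) \<le> L * \<bar>\<xi> - k\<bar>" if t: "0 < t" "t \<le> T" for t \<xi> k
  proof -
    have "norm (E t \<xi> - E t k) \<le> L * norm (\<xi> - k)"
    proof (rule differentiable_bound[where S=UNIV and f'="\<lambda>x h. h *\<^sub>R (- (of_real t * d\<phi> x * E t x))"])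
      show "(E t has_derivative (\<lambda>h. h *\<^sub>R (- (of_real t * d\<phi> x * E t x)))) (at x within UNIV)" for x
        using E_has_derivative by (simp add: has_vector_derivative_def)
      show "onorm (\<lambda>h. h *\<^sub>R (- (of_real t * d\<phi> x * E t x))) \<le> L" for x
      proof (rule onorm_le)
        fix h :: real
        have "norm (h *\<^sub>R (- (of_real t * d\<phi> x * E t x))) = norm (of_real t * d\<phi> x * E t x) * norm h"
          by (simp only: norm_scaleR norm_minus_cancel real_norm_def mult.commute)
        also have "\<dots> \<le> L * norm h" using d[OF t] by (rule mult_right_mono) simp
        finally show "norm (h *\<^sub>R (- (of_real t * d\<phi> x * E t x))) \<le> L * norm h" .
      qed
    qed auto
    then show ?thesis by simp
  qed
  with L d show thesis using that by blast
qed

text \<open>On the Fourier side the error is the transform of the packet times a Lipschitz function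
  vanishing at \<open>k\<close>. Since |\<xi> - k| is of size 1/R there, the error is bounded by L
  and its derivative by a multiple of L R; with Gaussian exponent R^2 the squared norm is O(1/R),
  while that of the packet is R / sqrt 2.\<close>

lemma packet_error:
  assumes T: "0 < T"
  obtains M where "0 < M"
    "\<And>t R k. 0 < t \<Longrightarrow> t \<le> T \<Longrightarrow> 0 < R \<Longrightarrow>
      (\<integral>\<^sup>+x. ennreal ((norm (Defs.convolution (fowler_kernel a b u t) (packet R k) x - E t k * packet R k x))\<^sup>2) \<partial>lborel)
      \<le> ennreal (M / R)"
proof -
  obtain L where L: "0 < L" and L1: "\<And>t \<xi>. 0 < t \<Longrightarrow> t \<le> T \<Longrightarrow> norm (of_real t * d\<phi> \<xi> * E t \<xi>) \<le> L"
    and L2: "\<And>t \<xi> k. 0 < t \<Longrightarrow> t \<le> T \<Longrightarrow> norm (E t \<xi> - E t k) \<le> L * \<bar>\<xi> - k\<bar>"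
    using E_lipschitz[OF T] by blast
  define M where "M = L * L * (1 + 2 * pi) * pi"
  have "(\<integral>\<^sup>+x. ennreal ((norm (Defs.convolution (fowler_kernel a b u t) (packet R k) x - E t k * packet R k x))\<^sup>2) \<partial>lborel)
      \<le> ennreal (M / R)" if t: "0 < t" "t \<le> T" and R: "0 < R" for t R k
  proof -
    define h where "h \<xi> = (E t \<xi> - E t k) * of_real (packet_hat R k \<xi>)" for \<xi>
    define h' where "h' \<xi> = (E t \<xi> - E t k) * of_real (packet_hat R k \<xi> * (- (2 * pi * R\<^sup>2) * (\<xi> - k)))
        + - (of_real t * d\<phi> \<xi> * E t \<xi>) * of_real (packet_hat R k \<xi>)" for \<xi>
    have gauss: "integrable lborel (packet_hat R k)"
      unfolding packet_hat_def[abs_def] using R by (intro integrable_mult_right gaussian_shifted_integrable) auto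
    define K where "K = exp (5 / 4 * \<Lambda> * t)"
    have bounded: "norm (E t \<xi>) \<le> \<bar>K\<bar>" for \<xi>
      using norm_E_le[of t \<xi>] t by (auto simp: K_def intro: order_trans mult_left_le)
    have i1: "integrable lborel (\<lambda>\<xi>. exp (2 * \<i> * of_real pi * of_real x * of_real \<xi>) * (E t \<xi> * of_real (packet_hat R k \<xi>)))" for x
      by (rule Bochner_Integration.integrable_bound[OF integrable_mult_right[OF gauss, of K]])
        (use R in \<open>auto simp: norm_mult abs_mult packet_hat_def intro!: AE_I2 mult_right_mono bounded\<close>)
    have i2: "integrable lborel (\<lambda>\<xi>. exp (2 * \<i> * of_real pi * of_real x * of_real \<xi>) * of_real (packet_hat R k \<xi>))" for x
      by (rule Bochner_Integration.integrable_bound[OF gauss]) (auto simp: norm_mult packet_hat_def)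
    have eq: "Defs.convolution (fowler_kernel a b u t) (packet R k) x - E t k * packet R k x = inverse_fourier h x" for x
    proof -
      have "E t k * packet R k x = E t k * inverse_fourier (\<lambda>\<xi>. of_real (packet_hat R k \<xi>)) x"
        by (simp add: packet_eq_inverse_fourier[OF R])
      then have "Defs.convolution (fowler_kernel a b u t) (packet R k) x - E t k * packet R k x
        = (LINT \<xi>|lborel. exp (2 * \<i> * of_real pi * of_real x * of_real \<xi>) * (E t \<xi> * of_real (packet_hat R k \<xi>)))
         - (LINT \<xi>|lborel. E t k * (exp (2 * \<i> * of_real pi * of_real x * of_real \<xi>) * of_real (packet_hat R k \<xi>)))"
        unfolding convolution_kernel_packet[OF t(1) R] inverse_fourier_def by simp
      also have "\<dots> = (LINT \<xi>|lborel. exp (2 * \<i> * of_real pi * of_real x * of_real \<xi>) * (E t \<xi> * of_real (packet_hat R k \<xi>))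
         - E t k * (exp (2 * \<i> * of_real pi * of_real x * of_real \<xi>) * of_real (packet_hat R k \<xi>)))"
        by (rule Bochner_Integration.integral_diff[OF i1 integrable_mult_right[OF i2], symmetric])
      also have "\<dots> = inverse_fourier h x"
        unfolding inverse_fourier_def h_def by (rule Bochner_Integration.integral_cong) (auto simp: algebra_simps)
      finally show ?thesis .
    qed
    have hat0: "0 \<le> packet_hat R k \<xi>" for \<xi> using R by (simp add: packet_hat_def)
    define z where "z \<xi> = R * \<bar>\<xi> - k\<bar>" for \<xi>
    have hat: "packet_hat R k \<xi> = R * exp (- (pi * (z \<xi>)\<^sup>2))" for \<xi>
      by (simp add: packet_hat_def z_def power_mult_distrib)
    have zz: "exp (- (z \<xi>)\<^sup>2) = exp (- R\<^sup>2 * (\<xi> - k)\<^sup>2)" for \<xi>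
      by (simp add: z_def power_mult_distrib)
    \<comment> \<open>As pi > 2, the Gaussian exp (- pi z^2) can absorb a factor z or z^2 and still
      leave exp (- z^2).\<close>
    have pz: "exp (- (pi * (z \<xi>)\<^sup>2)) \<le> exp (- (2 * (z \<xi>)\<^sup>2))" for \<xi>
      using pi_gt3 by (simp add: mult_right_mono)
    have pz0: "exp (- (pi * (z \<xi>)\<^sup>2)) \<le> exp (- (z \<xi>)\<^sup>2)" for \<xi>
      using pi_gt3 by (simp add: mult_le_cancel_right1)
    have z1: "z \<xi> * exp (- (pi * (z \<xi>)\<^sup>2)) \<le> exp (- (z \<xi>)\<^sup>2)" for \<xi>
    proof -
      have "z \<xi> * exp (- (pi * (z \<xi>)\<^sup>2)) \<le> exp ((z \<xi>)\<^sup>2) * exp (- (2 * (z \<xi>)\<^sup>2))"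
        using abs_le_exp_square[of "z \<xi>"] R by (intro mult_mono pz) (auto simp: z_def abs_mult)
      also have "\<dots> = exp (- (z \<xi>)\<^sup>2)" by (simp flip: exp_add)
      finally show ?thesis .
    qed
    have z2: "(z \<xi>)\<^sup>2 * exp (- (pi * (z \<xi>)\<^sup>2)) \<le> exp (- (z \<xi>)\<^sup>2)" for \<xi>
    proof -
      have "(z \<xi>)\<^sup>2 * exp (- (pi * (z \<xi>)\<^sup>2)) \<le> exp ((z \<xi>)\<^sup>2) * exp (- (2 * (z \<xi>)\<^sup>2))"
        by (intro mult_mono pz le_exp) auto
      also have "\<dots> = exp (- (z \<xi>)\<^sup>2)" by (simp flip: exp_add)
      finally show ?thesis .
    qed
    have "(\<integral>\<^sup>+x. ennreal ((norm (inverse_fourier h x))\<^sup>2) \<partial>lborel)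
      \<le> ennreal (L * (L * R * (1 + 2 * pi)) * pi / R\<^sup>2)"
    proof (rule inverse_fourier_L2_bound[where h' = h' and k = k])
      show "(h has_vector_derivative h' \<xi>) (at \<xi>)" for \<xi>
      proof -
        have "(packet_hat R k has_real_derivative packet_hat R k \<xi> * (- (2 * pi * R\<^sup>2) * (\<xi> - k))) (at \<xi>)"
          unfolding packet_hat_def[abs_def]
          by (rule derivative_eq_intros refl | simp)+
        then have 1: "((\<lambda>\<xi>. of_real (packet_hat R k \<xi>)) has_vector_derivative
            complex_of_real (packet_hat R k \<xi> * (- (2 * pi * R\<^sup>2) * (\<xi> - k)))) (at \<xi>)"
          by (intro has_vector_derivative_of_real) (simp add: has_real_derivative_iff_has_vector_derivative)
        have 2: "((\<lambda>\<xi>. E t \<xi> - E t k) has_vector_derivative - (of_real t * d\<phi> \<xi> * E t \<xi>)) (at \<xi>)"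
          using has_vector_derivative_diff[OF E_has_derivative has_vector_derivative_const] by simp
        show ?thesis unfolding h_def[abs_def] h'_def by (rule has_vector_derivative_mult[OF 2 1])
      qed
      show "isCont h' \<xi>" for \<xi>
        unfolding h'_def[abs_def] packet_hat_def by (intro continuous_intros isCont_d\<phi> isCont_E)
      show "norm (h \<xi>) \<le> L * exp (- R\<^sup>2 * (\<xi> - k)\<^sup>2)" for \<xi>
      proof -
        have "norm (h \<xi>) \<le> (L * \<bar>\<xi> - k\<bar>) * packet_hat R k \<xi>"
          unfolding h_def norm_mult norm_of_real abs_of_nonneg[OF hat0] by (rule mult_right_mono[OF L2[OF t] hat0])
        also have "\<dots> = L * (z \<xi> * exp (- (pi * (z \<xi>)\<^sup>2)))" by (simp add: hat z_def)
        also have "\<dots> \<le> L * exp (- (z \<xi>)\<^sup>2)" using L z1 by (intro mult_left_mono) auto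
        finally show ?thesis unfolding zz .
      qed
      show "norm (h' \<xi>) \<le> (L * R * (1 + 2 * pi)) * exp (- R\<^sup>2 * (\<xi> - k)\<^sup>2)" for \<xi>
      proof -
        have rearrange: "(L * d) * ((R * e) * ((2 * pi * R\<^sup>2) * d)) + L * (R * e)
            = L * R * (2 * pi * ((R * d)\<^sup>2 * e) + e)" for d e
          by (simp add: power2_eq_square algebra_simps)
        have "norm (h' \<xi>) \<le> norm (E t \<xi> - E t k) * (packet_hat R k \<xi> * ((2 * pi * R\<^sup>2) * \<bar>\<xi> - k\<bar>))
            + norm (of_real t * d\<phi> \<xi> * E t \<xi>) * packet_hat R k \<xi>"
          unfolding h'_def by (rule order_trans[OF norm_triangle_ineq])
            (simp only: norm_mult norm_minus_cancel norm_of_real abs_mult abs_minus abs_of_nonneg[OF hat0], simp)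
        also have "\<dots> \<le> (L * \<bar>\<xi> - k\<bar>) * (packet_hat R k \<xi> * ((2 * pi * R\<^sup>2) * \<bar>\<xi> - k\<bar>)) + L * packet_hat R k \<xi>"
          by (intro add_mono mult_right_mono L1 L2 t hat0 mult_nonneg_nonneg) auto
        also have "\<dots> = L * R * (2 * pi * ((z \<xi>)\<^sup>2 * exp (- (pi * (z \<xi>)\<^sup>2))) + exp (- (pi * (z \<xi>)\<^sup>2)))"
          unfolding hat z_def by (rule rearrange)
        also have "\<dots> \<le> L * R * (2 * pi * exp (- (z \<xi>)\<^sup>2) + exp (- (z \<xi>)\<^sup>2))"
          using L R z2 pz0 by (intro mult_left_mono add_mono) auto
        also have "\<dots> = (L * R * (1 + 2 * pi)) * exp (- (z \<xi>)\<^sup>2)" by (simp add: algebra_simps)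
        finally show ?thesis unfolding zz .
      qed
    qed (use L R in \<open>auto intro!: mult_pos_pos add_pos_pos\<close>)
    also have "L * (L * R * (1 + 2 * pi)) * pi / R\<^sup>2 = M / R"
      using R by (simp add: M_def power2_eq_square)
    finally show ?thesis unfolding eq .
  qed
  moreover have "0 < M" using L by (simp add: M_def add_pos_pos)
  ultimately show thesis using that by blast
qed

end

section \<open>Real waves built from two packets\<close>

lemma norm_square_add_le: "(norm (x + y))\<^sup>2 \<le> 2 * (norm x)\<^sup>2 + 2 * (norm y)\<^sup>2"
  for x y :: "'a::real_normed_vector"
proof -
  have "(norm (x + y))\<^sup>2 \<le> (norm x + norm y)\<^sup>2" by (intro power_mono norm_triangle_ineq) auto
  also have "\<dots> \<le> 2 * (norm x)\<^sup>2 + 2 * (norm y)\<^sup>2"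
    using zero_le_power2[of "norm x - norm y"] by (simp add: power2_sum power2_diff)
  finally show ?thesis .
qed

lemma two_ennreal_add_two_ennreal:
  assumes "0 \<le> x" "0 \<le> y"
  shows "2 * ennreal x + 2 * ennreal y = ennreal (2 * x + 2 * y)"
  using assms by (subst ennreal_plus) (simp_all add: ennreal_mult')

lemma nn_integral_norm_square_add_le:
  fixes f g :: "real \<Rightarrow> complex"
  assumes [measurable]: "f \<in> borel_measurable borel" "g \<in> borel_measurable borel"
  shows "(\<integral>\<^sup>+x. ennreal ((norm (f x + g x))\<^sup>2) \<partial>lborel)
    \<le> 2 * (\<integral>\<^sup>+x. ennreal ((norm (f x))\<^sup>2) \<partial>lborel) + 2 * (\<integral>\<^sup>+x. ennreal ((norm (g x))\<^sup>2) \<partial>lborel)"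
proof -
  have "(\<integral>\<^sup>+x. ennreal ((norm (f x + g x))\<^sup>2) \<partial>lborel)
      \<le> (\<integral>\<^sup>+x. 2 * ennreal ((norm (f x))\<^sup>2) + 2 * ennreal ((norm (g x))\<^sup>2) \<partial>lborel)"
  proof (intro nn_integral_mono)
    fix x
    have "ennreal ((norm (f x + g x))\<^sup>2) \<le> ennreal (2 * (norm (f x))\<^sup>2 + 2 * (norm (g x))\<^sup>2)"
      by (intro ennreal_leI norm_square_add_le)
    also have "\<dots> = 2 * ennreal ((norm (f x))\<^sup>2) + 2 * ennreal ((norm (g x))\<^sup>2)"
      by (simp add: ennreal_plus ennreal_mult)
    finally show "ennreal ((norm (f x + g x))\<^sup>2) \<le> 2 * ennreal ((norm (f x))\<^sup>2) + 2 * ennreal ((norm (g x))\<^sup>2)" .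
  qed
  also have "\<dots> = 2 * (\<integral>\<^sup>+x. ennreal ((norm (f x))\<^sup>2) \<partial>lborel) + 2 * (\<integral>\<^sup>+x. ennreal ((norm (g x))\<^sup>2) \<partial>lborel)"
    by (simp add: nn_integral_add nn_integral_cmult)
  finally show ?thesis .
qed

text \<open>The phase is a parameter because the evolution changes it: a wave starting with phase 0
  is at time t close to an amplified wave with phase
  \<open>t * Im (\<phi> \<xi>max)\<close>.\<close>

definition wave :: "real \<Rightarrow> real \<Rightarrow> real \<Rightarrow> real \<Rightarrow> real" where
  "wave R k \<theta> x = exp (- (pi / R\<^sup>2) * x\<^sup>2) * cos (2 * pi * k * x - \<theta>)"

lemma wave_measurable[measurable]: "wave R k \<theta> \<in> borel_measurable borel"
  unfolding wave_def[abs_def] by measurable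

lemma wave_eq_packets:
  "complex_of_real (wave R k \<theta> x)
    = (exp (- (\<i> * of_real \<theta>)) * packet R k x + exp (\<i> * of_real \<theta>) * packet R (- k) x) / 2"
proof -
  have cis_add_cnj: "cis y + cis (- y) = 2 * of_real (cos y)" for y
    by (simp add: complex_eq_iff)
  have 1: "exp (- (\<i> * of_real \<theta>)) * exp (\<i> * of_real (2 * pi * k * x)) = cis (2 * pi * k * x - \<theta>)"
    by (simp add: cis_conv_exp algebra_simps flip: exp_add)
  have 2: "exp (\<i> * of_real \<theta>) * exp (\<i> * of_real (2 * pi * (- k) * x)) = cis (- (2 * pi * k * x - \<theta>))"
    by (simp add: cis_conv_exp algebra_simps flip: exp_add)
  have "exp (- (\<i> * of_real \<theta>)) * packet R k x + exp (\<i> * of_real \<theta>) * packet R (- k) x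
      = of_real (exp (- (pi / R\<^sup>2) * x\<^sup>2)) * (cis (2 * pi * k * x - \<theta>) + cis (- (2 * pi * k * x - \<theta>)))"
    unfolding 1[symmetric] 2[symmetric] packet_def by (simp only: distrib_left ac_simps)
  also have "cis (2 * pi * k * x - \<theta>) + cis (- (2 * pi * k * x - \<theta>)) = 2 * of_real (cos (2 * pi * k * x - \<theta>))"
    by (rule cis_add_cnj)
  finally show ?thesis by (simp add: wave_def)
qed

text \<open>Halving the angle in cos^2 splits off the envelope; the remaining term is the
  interference of the two packets, a Gaussian Fourier integral at the doubled frequency and hence
  exponentially small in (k R)^2.\<close>

lemma wave_square:
  assumes R: "0 < R"
  shows wave_square_integrable: "integrable lborel (\<lambda>x. (wave R k \<theta> x)\<^sup>2)"
    and wave_square_integral: "(LINT x|lborel. (wave R k \<theta> x)\<^sup>2)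
      = R / sqrt 2 * ((1 + cos (2 * \<theta>) * exp (- (2 * pi * k\<^sup>2 * R\<^sup>2))) / 2)"
proof -
  define \<alpha> where "\<alpha> = 2 * pi / R\<^sup>2"
  have \<alpha>: "0 < \<alpha>" using R by (simp add: \<alpha>_def)
  let ?g = "\<lambda>x. exp (- \<alpha> * x\<^sup>2)"
  let ?f = "\<lambda>x. exp (\<i> * of_real ((4 * pi * k) * x)) * complex_of_real (?g x)"
  have i: "integrable lborel ?f"
    by (rule Bochner_Integration.integrable_bound[OF gaussian_integrable[OF \<alpha>]])
      (simp_all only: norm_mult norm_exp_i_times norm_of_real, simp_all)
  have eq: "(wave R k \<theta> x)\<^sup>2 = (?g x + Re (exp (- (\<i> * of_real (2 * \<theta>))) * ?f x)) / 2" for x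
  proof -
    have 1: "exp (- (pi / R\<^sup>2) * x\<^sup>2) ^ 2 = ?g x"
      by (simp add: \<alpha>_def flip: exp_of_nat_mult)
    have "exp (- (\<i> * of_real (2 * \<theta>))) * ?f x = cis (2 * (2 * pi * k * x - \<theta>)) * of_real (?g x)"
      by (simp add: cis_conv_exp algebra_simps flip: exp_add)
    then have "Re (exp (- (\<i> * of_real (2 * \<theta>))) * ?f x) = Re (cis (2 * (2 * pi * k * x - \<theta>)) * of_real (?g x))"
      by (rule arg_cong)
    also have "\<dots> = cos (2 * (2 * pi * k * x - \<theta>)) * ?g x" by simp
    finally have 2: "Re (exp (- (\<i> * of_real (2 * \<theta>))) * ?f x) = cos (2 * (2 * pi * k * x - \<theta>)) * ?g x" .
    have 3: "(cos y)\<^sup>2 = (1 + cos (2 * y)) / 2" for y :: real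
      by (simp add: cos_double_cos)
    show ?thesis unfolding wave_def power_mult_distrib 1 2 3 by (simp add: distrib_left mult.commute)
  qed
  have i2: "integrable lborel (\<lambda>x. exp (- (\<i> * of_real (2 * \<theta>))) * ?f x)"
    by (rule integrable_mult_right) (rule i)
  show "integrable lborel (\<lambda>x. (wave R k \<theta> x)\<^sup>2)"
    unfolding eq by (intro integrable_divide_zero Bochner_Integration.integrable_add gaussian_integrable \<alpha> integrable_Re i2)
  have rt: "sqrt (pi / \<alpha>) = R / sqrt 2"
    using R by (simp add: \<alpha>_def real_sqrt_divide)
  have ex: "- ((4 * pi * k)\<^sup>2 / (4 * \<alpha>)) = - (2 * pi * k\<^sup>2 * R\<^sup>2)"
    using R by (simp add: \<alpha>_def field_simps power2_eq_square)
  have "(LINT x|lborel. Re (exp (- (\<i> * of_real (2 * \<theta>))) * ?f x))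
      = Re (LINT x|lborel. exp (- (\<i> * of_real (2 * \<theta>))) * ?f x)"
    by (rule integral_Re[OF i2])
  also have "\<dots> = Re (exp (- (\<i> * of_real (2 * \<theta>))) * of_real (sqrt (pi / \<alpha>) * exp (- ((4 * pi * k)\<^sup>2 / (4 * \<alpha>)))))"
    by (subst integral_mult_right_zero, subst gaussian_fourier[OF \<alpha>]) (rule refl)
  also have "\<dots> = cos (2 * \<theta>) * (R / sqrt 2 * exp (- (2 * pi * k\<^sup>2 * R\<^sup>2)))"
    unfolding rt ex by (simp add: Re_exp)
  finally have re: "(LINT x|lborel. Re (exp (- (\<i> * of_real (2 * \<theta>))) * ?f x)) = cos (2 * \<theta>) * (R / sqrt 2 * exp (- (2 * pi * k\<^sup>2 * R\<^sup>2)))" .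
  have "(LINT x|lborel. (wave R k \<theta> x)\<^sup>2) = ((LINT x|lborel. ?g x) + (LINT x|lborel. Re (exp (- (\<i> * of_real (2 * \<theta>))) * ?f x))) / 2"
    unfolding eq
    by (subst integral_divide_zero, subst Bochner_Integration.integral_add[OF gaussian_integrable[OF \<alpha>] integrable_Re[OF i2]]) (rule refl)
  also have "\<dots> = R / sqrt 2 * ((1 + cos (2 * \<theta>) * exp (- (2 * pi * k\<^sup>2 * R\<^sup>2))) / 2)"
    unfolding re gaussian_integral[OF \<alpha>] rt by (simp add: algebra_simps)
  finally show "(LINT x|lborel. (wave R k \<theta> x)\<^sup>2)
      = R / sqrt 2 * ((1 + cos (2 * \<theta>) * exp (- (2 * pi * k\<^sup>2 * R\<^sup>2))) / 2)" .
qed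

lemma wave_square_integral_le:
  assumes "0 < R"
  shows "(LINT x|lborel. (wave R k \<theta> x)\<^sup>2) \<le> R / sqrt 2"
proof -
  have "cos (2 * \<theta>) * exp (- (2 * pi * k\<^sup>2 * R\<^sup>2)) \<le> 1 * 1"
    by (intro mult_mono) auto
  then have "R / sqrt 2 * ((1 + cos (2 * \<theta>) * exp (- (2 * pi * k\<^sup>2 * R\<^sup>2))) / 2) \<le> R / sqrt 2 * 1"
    using assms by (intro mult_left_mono) auto
  then show ?thesis unfolding wave_square_integral[OF assms] by simp
qed

text \<open>Once k R >= 1 the interference is at most 1/2 in modulus, so a quarter of R / sqrt 2
  survives. The bound has to be uniform in \<theta>, since the phase depends on time.\<close>

lemma wave_square_integral_ge:
  assumes R: "0 < R" and "1 \<le> k * R"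
  shows "R / sqrt 2 / 4 \<le> (LINT x|lborel. (wave R k \<theta> x)\<^sup>2)"
proof -
  have "1 \<le> (k * R)\<^sup>2" using assms by simp
  then have "2 * 3 * 1 \<le> 2 * pi * (k * R)\<^sup>2" using pi_gt3 by (intro mult_mono) auto
  moreover have "2 * pi * (k * R)\<^sup>2 = 2 * pi * k\<^sup>2 * R\<^sup>2" by (simp add: power_mult_distrib)
  ultimately have "1 \<le> 2 * pi * k\<^sup>2 * R\<^sup>2" by linarith
  then have "exp (1::real) \<le> exp (2 * pi * k\<^sup>2 * R\<^sup>2)" by simp
  then have "2 \<le> exp (2 * pi * k\<^sup>2 * R\<^sup>2)" using exp_ge_add_one_self[of "1::real"] by linarith
  then have e: "exp (- (2 * pi * k\<^sup>2 * R\<^sup>2)) \<le> 1 / 2" by (simp add: exp_minus field_simps)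
  have "\<bar>cos (2 * \<theta>) * exp (- (2 * pi * k\<^sup>2 * R\<^sup>2))\<bar> \<le> 1 * (1 / 2)"
    unfolding abs_mult using e by (intro mult_mono) auto
  then have "R / sqrt 2 * (1 / 4) \<le> R / sqrt 2 * ((1 + cos (2 * \<theta>) * exp (- (2 * pi * k\<^sup>2 * R\<^sup>2))) / 2)"
    using R by (intro mult_left_mono) auto
  then show ?thesis unfolding wave_square_integral[OF R] by simp
qed

context fowler
begin

abbreviation S :: "real \<Rightarrow> (real \<Rightarrow> real) \<Rightarrow> real \<Rightarrow> complex" where
  "S t v0 \<equiv> Defs.convolution (fowler_kernel a b u t) (\<lambda>y. of_real (v0 y))"

lemma inverse_fourier_measurable[measurable]:
  assumes [measurable]: "g \<in> borel_measurable borel"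
  shows "inverse_fourier g \<in> borel_measurable borel"
  unfolding inverse_fourier_def[abs_def] by measurable

lemma packet_hat_measurable[measurable]: "packet_hat R k \<in> borel_measurable borel"
  unfolding packet_hat_def[abs_def] by measurable

lemma convolution_packet_measurable:
  assumes "0 < t" "0 < R"
  shows "Defs.convolution (fowler_kernel a b u t) (packet R k) \<in> borel_measurable borel"
  unfolding convolution_kernel_packet[OF assms, abs_def] by measurable

lemma S_wave_eq:
  assumes t: "0 < t" and R: "0 < R"
  shows "S t (\<lambda>x. c * wave R k 0 x) = (\<lambda>x. of_real (c / 2) *
    (Defs.convolution (fowler_kernel a b u t) (packet R k) x + Defs.convolution (fowler_kernel a b u t) (packet R (- k)) x))"
proof
  fix x
  have "S t (\<lambda>x. c * wave R k 0 x) x = (LINT y|lborel. of_real (c / 2) * (fowler_kernel a b u t (x - y) * packet R k y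
      + fowler_kernel a b u t (x - y) * packet R (- k) y))"
    unfolding Defs.convolution_def
    by (rule Bochner_Integration.integral_cong) (simp_all add: wave_eq_packets algebra_simps)
  then show "S t (\<lambda>x. c * wave R k 0 x) x = of_real (c / 2) *
    (Defs.convolution (fowler_kernel a b u t) (packet R k) x + Defs.convolution (fowler_kernel a b u t) (packet R (- k)) x)"
    unfolding Defs.convolution_def integral_mult_right_zero
    by (simp only: Bochner_Integration.integral_add[OF integrable_kernel_packet[OF t R] integrable_kernel_packet[OF t R]])
qed

lemma S_wave_measurable:
  assumes "0 < t" "0 < R"
  shows "S t (\<lambda>x. c * wave R k 0 x) \<in> borel_measurable borel"
  unfolding S_wave_eq[OF assms] using convolution_packet_measurable[OF assms] by measurable

text \<open>By Hermitian symmetry the two frequencies have equal growth and opposite phases, so the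
  amplified packets recombine into a real wave.\<close>

lemma E_\<xi>max:
  "E t \<xi>max = of_real (exp (\<Lambda> * t)) * exp (- (\<i> * of_real (t * Im (\<phi> \<xi>max))))"
  "E t (- \<xi>max) = of_real (exp (\<Lambda> * t)) * exp (\<i> * of_real (t * Im (\<phi> \<xi>max)))"
proof -
  have "\<phi> \<xi>max = of_real (- \<Lambda>) + \<i> * of_real (Im (\<phi> \<xi>max))"
    using Re_\<phi>_\<xi>max by (simp add: complex_eq_iff)
  then have 1: "- (of_real t * \<phi> \<xi>max) = of_real (\<Lambda> * t) + - (\<i> * of_real (t * Im (\<phi> \<xi>max)))"
    by (simp add: complex_eq_iff Re_\<phi>_\<xi>max)
  have 2: "- (of_real t * \<phi> (- \<xi>max)) = of_real (\<Lambda> * t) + \<i> * of_real (t * Im (\<phi> \<xi>max))"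
    by (simp add: \<phi>_minus complex_eq_iff Re_\<phi>_\<xi>max)
  show "E t \<xi>max = of_real (exp (\<Lambda> * t)) * exp (- (\<i> * of_real (t * Im (\<phi> \<xi>max))))"
    unfolding E_def 1 exp_add exp_of_real ..
  show "E t (- \<xi>max) = of_real (exp (\<Lambda> * t)) * exp (\<i> * of_real (t * Im (\<phi> \<xi>max)))"
    unfolding E_def 2 exp_add exp_of_real ..
qed

text \<open>Let X be the squared amplitude c^2 (R / sqrt 2) exp (2 \<Lambda> t). The amplified wave
  has squared norm between X/4 and X, and the evolution differs from it by at most X/64. With |x +
  y|^2 <= 2 |x|^2 + 2 |y|^2 this gives 2 + 1/32 <= 3 above and (1/4 - 1/32) / 2 = 7/64 below. The
  width depends on the horizon T, not on t or c.\<close>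

lemma linear_evolution_bounds:
  assumes T: "0 < T"
  obtains R where "0 < R"
    "\<And>t c. 0 < t \<Longrightarrow> t \<le> T \<Longrightarrow>
      (\<integral>\<^sup>+x. ennreal ((norm (S t (\<lambda>x. c * wave R \<xi>max 0 x) x))\<^sup>2) \<partial>lborel)
        \<le> ennreal (3 * (c\<^sup>2 * (R / sqrt 2) * exp (2 * \<Lambda> * t)))"
    "\<And>t c. 0 < t \<Longrightarrow> t \<le> T \<Longrightarrow>
      ennreal (7 / 64 * (c\<^sup>2 * (R / sqrt 2) * exp (2 * \<Lambda> * t)))
        \<le> (\<integral>\<^sup>+x. ennreal ((norm (S t (\<lambda>x. c * wave R \<xi>max 0 x) x))\<^sup>2) \<partial>lborel)"
proof -
  obtain M where M: "0 < M" and err: "\<And>t R k. 0 < t \<Longrightarrow> t \<le> T \<Longrightarrow> 0 < R \<Longrightarrow>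
      (\<integral>\<^sup>+x. ennreal ((norm (Defs.convolution (fowler_kernel a b u t) (packet R k) x - E t k * packet R k x))\<^sup>2) \<partial>lborel)
      \<le> ennreal (M / R)"
    using packet_error[OF T] by blast
  \<comment> \<open>The first entry ensures \<open>\<xi>max\<close> R >= 1, which keeps the
    interference small. The second, with sqrt 2 <= 2, makes the packet error M/R at most 1/64 of R /
    sqrt 2.\<close>
  define R where "R = max (1 / \<xi>max) (sqrt (128 * M))"
  have R: "0 < R" using \<xi>max_pos by (simp add: R_def less_max_iff_disj)
  have kR: "1 \<le> \<xi>max * R"
  proof -
    have "\<xi>max * (1 / \<xi>max) \<le> \<xi>max * R" using \<xi>max_pos by (intro mult_left_mono) (auto simp: R_def)
    then show ?thesis using \<xi>max_pos by simp
  qed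
  have "sqrt (128 * M) ^ 2 \<le> R\<^sup>2" using M by (intro power_mono) (auto simp: R_def)
  then have "128 * M \<le> R * R" using M by (simp add: power2_eq_square)
  moreover have "sqrt 2 \<le> 2" by (simp add: real_le_lsqrt)
  then have "64 * M * sqrt 2 \<le> 64 * M * 2" using M by (intro mult_left_mono) auto
  ultimately have "64 * M * sqrt 2 \<le> R * R" by simp
  then have MR: "M / R \<le> R / sqrt 2 / 64" using R by (simp add: field_simps)
  have main: "(\<integral>\<^sup>+x. ennreal ((norm (S t (\<lambda>x. c * wave R \<xi>max 0 x) x))\<^sup>2) \<partial>lborel)
        \<le> ennreal (3 * (c\<^sup>2 * (R / sqrt 2) * exp (2 * \<Lambda> * t))) \<and>
      ennreal (7 / 64 * (c\<^sup>2 * (R / sqrt 2) * exp (2 * \<Lambda> * t)))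
        \<le> (\<integral>\<^sup>+x. ennreal ((norm (S t (\<lambda>x. c * wave R \<xi>max 0 x) x))\<^sup>2) \<partial>lborel)"
    if t: "0 < t" "t \<le> T" for t c
  proof -
    define X where "X = c\<^sup>2 * (R / sqrt 2) * exp (2 * \<Lambda> * t)"
    define \<theta> where "\<theta> = t * Im (\<phi> \<xi>max)"
    define f where "f x = S t (\<lambda>x. c * wave R \<xi>max 0 x) x" for x
    define g where "g x = complex_of_real (c * exp (\<Lambda> * t) * wave R \<xi>max \<theta> x)" for x
    define r where "r k x = Defs.convolution (fowler_kernel a b u t) (packet R k) x - E t k * packet R k x" for k x
    have X0: "0 \<le> X" using R by (simp add: X_def)
    have [measurable]: "f \<in> borel_measurable borel" "g \<in> borel_measurable borel" "r k \<in> borel_measurable borel" for k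
      using S_wave_measurable[OF t(1) R] convolution_packet_measurable[OF t(1) R]
      unfolding f_def[abs_def] g_def[abs_def] r_def[abs_def] by measurable
    have g: "g x = of_real (c / 2) * (E t \<xi>max * packet R \<xi>max x + E t (- \<xi>max) * packet R (- \<xi>max) x)" for x
      unfolding E_\<xi>max g_def of_real_mult wave_eq_packets \<theta>_def[symmetric] by (simp add: algebra_simps)
    have fg: "f x - g x = of_real (c / 2) * (r \<xi>max x + r (- \<xi>max) x)" for x
      unfolding f_def S_wave_eq[OF t(1) R] g r_def by (simp add: algebra_simps)
    have "(\<integral>\<^sup>+x. ennreal ((norm (f x - g x))\<^sup>2) \<partial>lborel)
        = ennreal (c\<^sup>2 / 4) * (\<integral>\<^sup>+x. ennreal ((norm (r \<xi>max x + r (- \<xi>max) x))\<^sup>2) \<partial>lborel)"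
    proof (subst nn_integral_cmult[symmetric])
      show "(\<integral>\<^sup>+x. ennreal ((norm (f x - g x))\<^sup>2) \<partial>lborel)
        = (\<integral>\<^sup>+x. ennreal (c\<^sup>2 / 4) * ennreal ((norm (r \<xi>max x + r (- \<xi>max) x))\<^sup>2) \<partial>lborel)"
        unfolding fg by (intro nn_integral_cong)
          (simp add: norm_mult power_mult_distrib power_divide flip: ennreal_mult)
    qed simp
    also have "\<dots> \<le> ennreal (c\<^sup>2 / 4) * (2 * ennreal (M / R) + 2 * ennreal (M / R))"
      by (intro mult_left_mono order_trans[OF nn_integral_norm_square_add_le] add_mono)
        (use err[OF t R, folded r_def] in auto)
    also have "\<dots> = ennreal (c\<^sup>2 / 4) * ennreal (4 * (M / R))"
    proof -
      have "2 * x + 2 * x = 4 * x" for x :: ennreal by (simp flip: distrib_right)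
      then show ?thesis by (simp only: ennreal_mult' zero_le_numeral ennreal_numeral)
    qed
    also have "\<dots> = ennreal (c\<^sup>2 / 4 * (4 * (M / R)))"
      using M R by (intro ennreal_mult[symmetric]) auto
    also have "\<dots> = ennreal (c\<^sup>2 * (M / R))" by simp
    also have "\<dots> \<le> ennreal (c\<^sup>2 * (R / sqrt 2 / 64) * exp (2 * \<Lambda> * t))"
    proof (rule ennreal_leI)
      have "c\<^sup>2 * (M / R) * 1 \<le> c\<^sup>2 * (R / sqrt 2 / 64) * exp (2 * \<Lambda> * t)"
        using MR R t \<Lambda>_pos by (intro mult_mono mult_left_mono) auto
      then show "c\<^sup>2 * (M / R) \<le> c\<^sup>2 * (R / sqrt 2 / 64) * exp (2 * \<Lambda> * t)" by simp
    qed
    also have "c\<^sup>2 * (R / sqrt 2 / 64) * exp (2 * \<Lambda> * t) = X / 64" by (simp add: X_def)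
    finally have d: "(\<integral>\<^sup>+x. ennreal ((norm (f x - g x))\<^sup>2) \<partial>lborel) \<le> ennreal (X / 64)" .
    have "(\<integral>\<^sup>+x. ennreal ((norm (g x))\<^sup>2) \<partial>lborel) = (\<integral>\<^sup>+x. ennreal (c\<^sup>2 * exp (2 * \<Lambda> * t) * (wave R \<xi>max \<theta> x)\<^sup>2) \<partial>lborel)"
      by (intro nn_integral_cong) (simp add: g_def norm_mult power_mult_distrib power_abs abs_mult flip: exp_double)
    also have "\<dots> = ennreal (LINT x|lborel. c\<^sup>2 * exp (2 * \<Lambda> * t) * (wave R \<xi>max \<theta> x)\<^sup>2)"
      by (intro nn_integral_eq_integral integrable_mult_right wave_square_integrable R) simp
    also have "(LINT x|lborel. c\<^sup>2 * exp (2 * \<Lambda> * t) * (wave R \<xi>max \<theta> x)\<^sup>2) = c\<^sup>2 * exp (2 * \<Lambda> * t) * (LINT x|lborel. (wave R \<xi>max \<theta> x)\<^sup>2)"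
      by (rule integral_mult_right_zero)
    finally have G: "(\<integral>\<^sup>+x. ennreal ((norm (g x))\<^sup>2) \<partial>lborel) = ennreal (c\<^sup>2 * exp (2 * \<Lambda> * t) * (LINT x|lborel. (wave R \<xi>max \<theta> x)\<^sup>2))" .
    have "c\<^sup>2 * exp (2 * \<Lambda> * t) * (LINT x|lborel. (wave R \<xi>max \<theta> x)\<^sup>2) \<le> c\<^sup>2 * exp (2 * \<Lambda> * t) * (R / sqrt 2)"
      by (intro mult_left_mono wave_square_integral_le R) auto
    then have G1: "(\<integral>\<^sup>+x. ennreal ((norm (g x))\<^sup>2) \<partial>lborel) \<le> ennreal X"
      unfolding G X_def by (intro ennreal_leI) (simp add: ac_simps)
    have "c\<^sup>2 * exp (2 * \<Lambda> * t) * (R / sqrt 2 / 4) \<le> c\<^sup>2 * exp (2 * \<Lambda> * t) * (LINT x|lborel. (wave R \<xi>max \<theta> x)\<^sup>2)"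
      by (intro mult_left_mono wave_square_integral_ge R kR) auto
    then have G2: "ennreal (X / 4) \<le> (\<integral>\<^sup>+x. ennreal ((norm (g x))\<^sup>2) \<partial>lborel)"
      unfolding G X_def by (intro ennreal_leI) (simp add: ac_simps)
    have "(\<integral>\<^sup>+x. ennreal ((norm (f x))\<^sup>2) \<partial>lborel) = (\<integral>\<^sup>+x. ennreal ((norm (g x + (f x - g x)))\<^sup>2) \<partial>lborel)"
      by simp
    also have "\<dots> \<le> 2 * ennreal X + 2 * ennreal (X / 64)"
      by (rule order_trans[OF nn_integral_norm_square_add_le]) (auto intro!: add_mono mult_left_mono G1 d)
    also have "\<dots> = ennreal (2 * X + 2 * (X / 64))" using X0 by (intro two_ennreal_add_two_ennreal) auto
    also have "\<dots> \<le> ennreal (3 * X)" using X0 by (intro ennreal_leI) simp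
    finally have upper: "(\<integral>\<^sup>+x. ennreal ((norm (f x))\<^sup>2) \<partial>lborel) \<le> ennreal (3 * X)" .
    \<comment> \<open>The upper bound makes the integral finite, so the lower bound can be obtained
      by subtraction among reals.\<close>
    then obtain F where F: "(\<integral>\<^sup>+x. ennreal ((norm (f x))\<^sup>2) \<partial>lborel) = ennreal F" "0 \<le> F"
      by (cases "\<integral>\<^sup>+x. ennreal ((norm (f x))\<^sup>2) \<partial>lborel") (auto simp: top_unique)
    have "ennreal (X / 4) \<le> (\<integral>\<^sup>+x. ennreal ((norm (f x + (g x - f x)))\<^sup>2) \<partial>lborel)"
      using G2 by simp
    also have "\<dots> \<le> 2 * ennreal F + 2 * ennreal (X / 64)"
      unfolding F(1)[symmetric] using d
      by (intro order_trans[OF nn_integral_norm_square_add_le]) (auto intro!: add_mono mult_left_mono simp: norm_minus_commute)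
    also have "\<dots> = ennreal (2 * F + 2 * (X / 64))" using X0 F by (intro two_ennreal_add_two_ennreal) auto
    finally have "X / 4 \<le> 2 * F + 2 * (X / 64)" using F X0 by (subst (asm) ennreal_le_iff) auto
    then have lower: "ennreal (7 / 64 * X) \<le> (\<integral>\<^sup>+x. ennreal ((norm (f x))\<^sup>2) \<partial>lborel)"
      unfolding F(1) by (intro ennreal_leI) simp
    from upper lower show ?thesis unfolding f_def X_def by blast
  qed
  show thesis using that[OF R] main by blast
qed

end

section \<open>The Duhamel term\<close>

text \<open>A non-integrable function has Bochner integral 0 by convention, so the inequality is
  unconditional; it lets the nested Duhamel integrals be estimated directly.\<close>

lemma norm_integral_le_nn_integral:
  fixes f :: "'a \<Rightarrow> complex"
  shows "ennreal (norm (LINT x|M. f x)) \<le> (\<integral>\<^sup>+x. ennreal (norm (f x)) \<partial>M)"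
proof (cases "integrable M f")
  case True
  then show ?thesis by (rule integral_norm_bound_ennreal)
qed (simp add: not_integrable_integral_eq)

lemma nn_integral_eq_L2_norm:
  assumes "in_L2 f"
  shows "(\<integral>\<^sup>+x. ennreal ((f x)\<^sup>2) \<partial>lborel) = ennreal ((L2_norm f)\<^sup>2)"
proof -
  have "0 \<le> (LINT x|lborel. (f x)\<^sup>2)" by simp
  then show ?thesis
    using assms by (simp add: in_L2_def L2_norm_def nn_integral_eq_integral)
qed

context fowler
begin

lemma bD_measurable[measurable]: "bD \<in> borel_measurable borel"
  unfolding bD_def[abs_def] by measurable

lemma bD_nonneg: "0 \<le> bD t" using cD_pos by (simp add: bD_def)

text \<open>Minkowski's inequality over \<open>(s, y)\<close> turns the space-time convolution into a time integral
  of \<open>L\<^sup>2\<close> norms of the kernel against \<open>L\<^sup>1\<close> norms of \<open>v\<^sup>2\<close>.\<close>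
lemma duhamel_bound:
  assumes v: "in_Linf_L2 T v" and t: "0 < t" "t < T"
  obtains G :: "real \<Rightarrow> ennreal" where "G \<in> borel_measurable borel"
    "\<And>x. ennreal (norm (LINT s:{0<..<t}|lborel.
        Defs.convolution (derivative (fowler_kernel a b u (t - s))) (\<lambda>y. of_real ((v s y)\<^sup>2 / 2)) x)) \<le> G x"
    "(\<integral>\<^sup>+x. (G x)\<^sup>2 \<partial>lborel) \<le>
      (\<integral>\<^sup>+s. ennreal (indicator {0<..<t} s * (bD (t - s) * ((L2_norm (v s))\<^sup>2 / 2))) \<partial>lborel)\<^sup>2"
proof -
  \<comment> \<open>Joint measurability is given for \<open>v\<close> on the strip (0,T) only;
    \<open>V\<close> is the extension by 0, measurable on the whole plane.\<close>
  define V where "V z = indicator ({0<..<T} \<times> UNIV) z *\<^sub>R (case z of (s, y) \<Rightarrow> v s y)" for z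
  have "V \<in> borel_measurable (lborel \<Otimes>\<^sub>M lborel)"
    using v unfolding in_Linf_L2_def set_borel_measurable_def V_def[abs_def] by (rule conjunct1)
  then have V[measurable]: "V \<in> borel_measurable (borel \<Otimes>\<^sub>M borel)"
    by (subst measurable_cong_sets[OF sets_pair_measure_cong[OF sets_lborel[symmetric] sets_lborel[symmetric]] refl])
  have Vv: "V (s, y) = v s y" if "0 < s" "s < t" for s y using that t by (simp add: V_def)
  define F where "F z x = ennreal (indicator {0<..<t} (fst z) * (norm (D (t - fst z) (x - snd z)) * ((V z)\<^sup>2 / 2)))" for z x
  define g where "g z = ennreal (indicator {0<..<t} (fst z) * (bD (t - fst z) * ((V z)\<^sup>2 / 2)))" for z
  \<comment> \<open>A measurable pointwise majorant of the Duhamel term; the L2 estimates are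
    carried out on it.\<close>
  define G where "G x = (\<integral>\<^sup>+z. F z x \<partial>(lborel \<Otimes>\<^sub>M lborel))" for x
  have F[measurable]: "case_prod F \<in> borel_measurable ((lborel \<Otimes>\<^sub>M lborel) \<Otimes>\<^sub>M lborel)"
    unfolding F_def case_prod_beta' by measurable
  have g[measurable]: "g \<in> borel_measurable (lborel \<Otimes>\<^sub>M lborel)"
    unfolding g_def[abs_def] by measurable
  have sl: "sigma_finite_measure (lborel :: real measure)" ..
  have sp: "sigma_finite_measure (lborel \<Otimes>\<^sub>M lborel :: (real \<times> real) measure)"
    unfolding lborel_prod ..
  have "G \<in> borel_measurable lborel"
  proof -
    interpret P: sigma_finite_measure "lborel \<Otimes>\<^sub>M lborel :: (real \<times> real) measure" by (rule sp)
    show ?thesis unfolding G_def[abs_def] by measurable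
  qed
  then have Gm: "G \<in> borel_measurable borel" by simp
  have Fbound: "(\<integral>\<^sup>+x. (F z x)\<^sup>2 \<partial>lborel) \<le> (g z)\<^sup>2" for z
  proof (cases "fst z \<in> {0<..<t}")
    case True
    let ?w = "(V z)\<^sup>2 / 2"
    have "(\<integral>\<^sup>+x. (F z x)\<^sup>2 \<partial>lborel) = (\<integral>\<^sup>+x. ennreal (?w\<^sup>2) * ennreal ((norm (D (t - fst z) (- snd z + 1 * x)))\<^sup>2) \<partial>lborel)"
      using True by (intro nn_integral_cong)
        (simp add: F_def ennreal_power power_mult_distrib power_divide ac_simps flip: ennreal_mult)
    also have "\<dots> = ennreal (?w\<^sup>2) * (\<integral>\<^sup>+x. ennreal ((norm (D (t - fst z) (- snd z + 1 * x)))\<^sup>2) \<partial>lborel)"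
      by (rule nn_integral_cmult) measurable
    also have "(\<integral>\<^sup>+x. ennreal ((norm (D (t - fst z) (- snd z + 1 * x)))\<^sup>2) \<partial>lborel)
        = (\<integral>\<^sup>+x. ennreal ((norm (D (t - fst z) x))\<^sup>2) \<partial>lborel)"
      using nn_integral_real_affine[of "\<lambda>x. ennreal ((norm (D (t - fst z) x))\<^sup>2)" 1 "- snd z"] by simp
    also have "ennreal (?w\<^sup>2) * \<dots> \<le> ennreal (?w\<^sup>2) * ennreal ((bD (t - fst z))\<^sup>2)"
      using True by (intro mult_left_mono D_L2_bound) auto
    also have "\<dots> = (g z)\<^sup>2"
      using True bD_nonneg[of "t - fst z"]
      by (simp add: g_def ennreal_power power_mult_distrib power_divide ac_simps flip: ennreal_mult)
    finally show ?thesis .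
  qed (simp add: F_def g_def)
  have Gint: "(\<integral>\<^sup>+x. (G x)\<^sup>2 \<partial>lborel) \<le> (\<integral>\<^sup>+z. g z \<partial>(lborel \<Otimes>\<^sub>M lborel))\<^sup>2"
    unfolding G_def by (rule minkowski_nn_integral[OF sl sp F g Fbound])
  have "(\<integral>\<^sup>+z. g z \<partial>(lborel \<Otimes>\<^sub>M lborel)) = (\<integral>\<^sup>+s. \<integral>\<^sup>+y. g (s, y) \<partial>lborel \<partial>lborel)"
    by (rule lborel.nn_integral_fst[OF g, symmetric])
  also have "\<dots> = (\<integral>\<^sup>+s. ennreal (indicator {0<..<t} s * (bD (t - s) * ((L2_norm (v s))\<^sup>2 / 2))) \<partial>lborel)"
  proof (rule nn_integral_cong)
    fix s :: real
    show "(\<integral>\<^sup>+y. g (s, y) \<partial>lborel) = ennreal (indicator {0<..<t} s * (bD (t - s) * ((L2_norm (v s))\<^sup>2 / 2)))"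
    proof (cases "s \<in> {0<..<t}")
      case True
      then have L2: "in_L2 (v s)" using v t by (auto simp: in_Linf_L2_def)
      then have [measurable]: "v s \<in> borel_measurable borel" by (simp add: in_L2_def)
      have "(\<integral>\<^sup>+y. g (s, y) \<partial>lborel) = (\<integral>\<^sup>+y. ennreal (bD (t - s) / 2) * ennreal ((v s y)\<^sup>2) \<partial>lborel)"
        using True bD_nonneg[of "t - s"] by (intro nn_integral_cong) (simp add: g_def Vv ac_simps flip: ennreal_mult)
      also have "\<dots> = ennreal (bD (t - s) / 2) * ennreal ((L2_norm (v s))\<^sup>2)"
        by (subst nn_integral_cmult) (simp_all add: nn_integral_eq_L2_norm[OF L2])
      also have "\<dots> = ennreal (bD (t - s) / 2 * (L2_norm (v s))\<^sup>2)"
        using bD_nonneg[of "t - s"] by (intro ennreal_mult[symmetric]) auto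
      finally show ?thesis using True by simp
    qed (simp add: g_def)
  qed
  finally have gint: "(\<integral>\<^sup>+z. g z \<partial>(lborel \<Otimes>\<^sub>M lborel))
      = (\<integral>\<^sup>+s. ennreal (indicator {0<..<t} s * (bD (t - s) * ((L2_norm (v s))\<^sup>2 / 2))) \<partial>lborel)" .
  have bound: "ennreal (norm (LINT s:{0<..<t}|lborel.
        Defs.convolution (derivative (fowler_kernel a b u (t - s))) (\<lambda>y. of_real ((v s y)\<^sup>2 / 2)) x)) \<le> G x" for x
  proof -
    let ?N = "\<lambda>s. Defs.convolution (derivative (fowler_kernel a b u (t - s))) (\<lambda>y. of_real ((v s y)\<^sup>2 / 2)) x"
    have [measurable]: "(\<lambda>z. F z x) \<in> borel_measurable (lborel \<Otimes>\<^sub>M lborel)" by measurable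
    have "ennreal (norm (LINT s:{0<..<t}|lborel. ?N s)) \<le> (\<integral>\<^sup>+s. ennreal (norm (indicator {0<..<t} s *\<^sub>R ?N s)) \<partial>lborel)"
      unfolding set_lebesgue_integral_def by (rule norm_integral_le_nn_integral)
    also have "\<dots> \<le> (\<integral>\<^sup>+s. \<integral>\<^sup>+y. F (s, y) x \<partial>lborel \<partial>lborel)"
    proof (rule nn_integral_mono)
      fix s :: real
      show "ennreal (norm (indicator {0<..<t} s *\<^sub>R ?N s)) \<le> (\<integral>\<^sup>+y. F (s, y) x \<partial>lborel)"
      proof (cases "s \<in> {0<..<t}")
        case True
        then have "ennreal (norm (indicator {0<..<t} s *\<^sub>R ?N s))
            = ennreal (norm (LINT y|lborel. D (t - s) (x - y) * complex_of_real ((v s y)\<^sup>2 / 2)))"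
          by (simp add: Defs.convolution_def derivative_fowler_kernel)
        also have "\<dots> \<le> (\<integral>\<^sup>+y. ennreal (norm (D (t - s) (x - y) * complex_of_real ((v s y)\<^sup>2 / 2))) \<partial>lborel)"
          by (rule norm_integral_le_nn_integral)
        also have "\<dots> = (\<integral>\<^sup>+y. F (s, y) x \<partial>lborel)"
          using True by (intro nn_integral_cong) (simp add: F_def Vv norm_mult norm_divide norm_power)
        finally show ?thesis .
      qed simp
    qed
    also have "\<dots> = G x" unfolding G_def by (rule lborel.nn_integral_fst) measurable
    finally show ?thesis .
  qed
  show thesis using that[OF Gm bound] Gint unfolding gint by blast
qed

text \<open>The L2 distance between v(t) and the linear evolution is at most \<open>e\<close>.
  Splitting each of the two functions as the other plus the difference gives both bounds: the first
  propagates the a priori estimate, the second yields the growth at the final time.\<close>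

lemma mild_solution_estimate:
  assumes mild: "mild_solution_on a b u T v0 v" and t: "0 < t" "t < T"
    and S[measurable]: "S t v0 \<in> borel_measurable borel"
    and e: "(\<integral>\<^sup>+s. ennreal (indicator {0<..<t} s * (bD (t - s) * ((L2_norm (v s))\<^sup>2 / 2))) \<partial>lborel) \<le> ennreal e" "0 \<le> e"
  shows "ennreal ((L2_norm (v t))\<^sup>2) \<le> 2 * (\<integral>\<^sup>+x. ennreal ((norm (S t v0 x))\<^sup>2) \<partial>lborel) + 2 * ennreal (e\<^sup>2)"
    and "(\<integral>\<^sup>+x. ennreal ((norm (S t v0 x))\<^sup>2) \<partial>lborel) \<le> 2 * ennreal ((L2_norm (v t))\<^sup>2) + 2 * ennreal (e\<^sup>2)"
proof -
  have v: "in_Linf_L2 T v" using mild by (simp add: mild_solution_on_def)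
  then have L2: "in_L2 (v t)" using t by (auto simp: in_Linf_L2_def)
  then have [measurable]: "v t \<in> borel_measurable borel" by (simp add: in_L2_def)
  obtain G :: "real \<Rightarrow> ennreal" where [measurable]: "G \<in> borel_measurable borel"
    and G: "\<And>x. ennreal (norm (LINT s:{0<..<t}|lborel.
        Defs.convolution (derivative (fowler_kernel a b u (t - s))) (\<lambda>y. of_real ((v s y)\<^sup>2 / 2)) x)) \<le> G x"
    and Gint: "(\<integral>\<^sup>+x. (G x)\<^sup>2 \<partial>lborel) \<le>
      (\<integral>\<^sup>+s. ennreal (indicator {0<..<t} s * (bD (t - s) * ((L2_norm (v s))\<^sup>2 / 2))) \<partial>lborel)\<^sup>2"
    using duhamel_bound[OF v t] by blast
  have diff: "AE x in lborel. ennreal (norm (complex_of_real (v t x) - S t v0 x)) \<le> G x"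
  proof -
    have "AE x in lborel. complex_of_real (v t x) = S t v0 x - (LINT s:{0<..<t}|lborel.
        Defs.convolution (derivative (fowler_kernel a b u (t - s))) (\<lambda>y. of_real ((v s y)\<^sup>2 / 2)) x)"
      using mild t by (auto simp: mild_solution_on_def)
    then show ?thesis
    proof (rule AE_mp, intro AE_I2 impI)
      fix x assume eq: "complex_of_real (v t x) = S t v0 x - (LINT s:{0<..<t}|lborel.
        Defs.convolution (derivative (fowler_kernel a b u (t - s))) (\<lambda>y. of_real ((v s y)\<^sup>2 / 2)) x)"
      show "ennreal (norm (complex_of_real (v t x) - S t v0 x)) \<le> G x"
        unfolding eq using G[of x] by simp
    qed
  qed
  have "(\<integral>\<^sup>+x. ennreal ((norm (complex_of_real (v t x) - S t v0 x))\<^sup>2) \<partial>lborel) \<le> (\<integral>\<^sup>+x. (G x)\<^sup>2 \<partial>lborel)"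
  proof (rule nn_integral_mono_AE, rule AE_mp[OF diff], intro AE_I2 impI)
    fix x assume "ennreal (norm (complex_of_real (v t x) - S t v0 x)) \<le> G x"
    from power_mono[OF this, of 2]
    show "ennreal ((norm (complex_of_real (v t x) - S t v0 x))\<^sup>2) \<le> (G x)\<^sup>2"
      by (simp add: ennreal_power)
  qed
  also have "\<dots> \<le> (ennreal e)\<^sup>2" using Gint e(1) by (meson order_trans power_mono zero_le)
  finally have d: "(\<integral>\<^sup>+x. ennreal ((norm (complex_of_real (v t x) - S t v0 x))\<^sup>2) \<partial>lborel) \<le> ennreal (e\<^sup>2)"
    using e(2) by (simp add: ennreal_power)
  have d': "(\<integral>\<^sup>+x. ennreal ((norm (S t v0 x - complex_of_real (v t x)))\<^sup>2) \<partial>lborel) \<le> ennreal (e\<^sup>2)"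
    using d by (simp only: norm_minus_commute)
  have vn: "(\<integral>\<^sup>+x. ennreal ((norm (complex_of_real (v t x)))\<^sup>2) \<partial>lborel) = ennreal ((L2_norm (v t))\<^sup>2)"
    using nn_integral_eq_L2_norm[OF L2] by simp
  have "(\<integral>\<^sup>+x. ennreal ((norm (S t v0 x + (complex_of_real (v t x) - S t v0 x)))\<^sup>2) \<partial>lborel)
      \<le> 2 * (\<integral>\<^sup>+x. ennreal ((norm (S t v0 x))\<^sup>2) \<partial>lborel) + 2 * ennreal (e\<^sup>2)"
    by (rule order_trans[OF nn_integral_norm_square_add_le]) (auto intro!: add_mono mult_left_mono d)
  then show "ennreal ((L2_norm (v t))\<^sup>2) \<le> 2 * (\<integral>\<^sup>+x. ennreal ((norm (S t v0 x))\<^sup>2) \<partial>lborel) + 2 * ennreal (e\<^sup>2)"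
    using vn by simp
  have "(\<integral>\<^sup>+x. ennreal ((norm (complex_of_real (v t x) + (S t v0 x - complex_of_real (v t x))))\<^sup>2) \<partial>lborel)
      \<le> 2 * ennreal ((L2_norm (v t))\<^sup>2) + 2 * ennreal (e\<^sup>2)"
    unfolding vn[symmetric]
    by (rule order_trans[OF nn_integral_norm_square_add_le]) (auto intro!: add_mono mult_left_mono d')
  then show "(\<integral>\<^sup>+x. ennreal ((norm (S t v0 x))\<^sup>2) \<partial>lborel) \<le> 2 * ennreal ((L2_norm (v t))\<^sup>2) + 2 * ennreal (e\<^sup>2)"
    by simp
qed

end

section \<open>Bootstrap\<close>

text \<open>Scaling by c turns the integral, up to powers of c, into Gamma (1/4), which is
  finite.\<close>

lemma nn_integral_powr_exp_finite:
  assumes c: "0 < (c::real)"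
  obtains J where "0 \<le> J"
    "(\<integral>\<^sup>+s. ennreal (indicator {0<..} s * (s powr (- 3 / 4) * exp (- (c * s)))) \<partial>lborel) = ennreal J"
proof -
  let ?f = "\<lambda>s. ennreal (indicator {0<..} s * (s powr (- 3 / 4) * exp (- (c * s))))"
  have "ennreal (Gamma (1 / 4)) = (\<integral>\<^sup>+t. ennreal (indicator {0..} t * t powr (1 / 4 - 1) / exp t) \<partial>lborel)"
    by (rule Gamma_conv_nn_integral_real) simp
  also have "\<dots> = ennreal c * (\<integral>\<^sup>+s. ennreal (indicator {0..} (0 + c * s) * (0 + c * s) powr (1 / 4 - 1) / exp (0 + c * s)) \<partial>lborel)"
    using nn_integral_real_affine[of "\<lambda>t. ennreal (indicator {0..} t * t powr (1 / 4 - 1) / exp t)" c 0] c by simp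
  also have "(\<integral>\<^sup>+s. ennreal (indicator {0..} (0 + c * s) * (0 + c * s) powr (1 / 4 - 1) / exp (0 + c * s)) \<partial>lborel)
      = (\<integral>\<^sup>+s. ennreal (c powr (- 3 / 4)) * ?f s \<partial>lborel)"
  proof (rule nn_integral_cong)
    fix s :: real
    \<comment> \<open>The two indicators differ only at s = 0, where both integrands vanish because
      \<open>powr\<close> has value 0 at base 0.\<close>
    consider "s < 0" | "s = 0" | "0 < s" by linarith
    then show "ennreal (indicator {0..} (0 + c * s) * (0 + c * s) powr (1 / 4 - 1) / exp (0 + c * s)) = ennreal (c powr (- 3 / 4)) * ?f s"
    proof cases
      case 1
      then have "c * s < 0" using c by (rule mult_pos_neg[rotated])
      then show ?thesis using 1 by simp
    next
      case 3
      have "(c * s) powr (1 / 4 - 1) / exp (c * s) = c powr (- 3 / 4) * (s powr (- 3 / 4) * exp (- (c * s)))"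
        using 3 c by (simp add: powr_mult exp_minus field_simps)
      moreover have "ennreal (c powr (- 3 / 4)) * ?f s = ennreal (c powr (- 3 / 4) * (s powr (- 3 / 4) * exp (- (c * s))))"
        using 3 by (subst ennreal_mult) auto
      moreover have "0 \<le> c * s" using 3 c by simp
      ultimately show ?thesis by simp
    qed simp
  qed
  also have "\<dots> = ennreal (c powr (- 3 / 4)) * (\<integral>\<^sup>+s. ?f s \<partial>lborel)"
    by (rule nn_integral_cmult) measurable
  finally have *: "ennreal (Gamma (1 / 4)) = ennreal c * (ennreal (c powr (- 3 / 4)) * (\<integral>\<^sup>+s. ?f s \<partial>lborel))" .
  have "(\<integral>\<^sup>+s. ?f s \<partial>lborel) \<noteq> top"
  proof
    assume "(\<integral>\<^sup>+s. ?f s \<partial>lborel) = top"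
    with * c show False by (simp add: ennreal_mult_top)
  qed
  then show thesis using that by (cases "\<integral>\<^sup>+s. ?f s \<partial>lborel") auto
qed

lemma nn_integral_powr_near_0:
  assumes "0 \<le> (h::real)"
  shows "(\<integral>\<^sup>+s. ennreal (indicator {0..h} s * s powr (- 3 / 4)) \<partial>lborel) = ennreal (4 * h powr (1 / 4))"
proof -
  have "((\<lambda>x. x powr (- 3 / 4)) has_integral (h powr (- 3 / 4 + 1) / (- 3 / 4 + 1))) {0..h}"
    using assms by (intro has_integral_powr_from_0) auto
  then have "((\<lambda>x. x powr (- 3 / 4)) has_integral (4 * h powr (1 / 4))) {0..h}" by (simp add: mult.commute)
  from nn_integral_has_integral_lebesgue[OF _ this] show ?thesis by simp
qed

context fowler
begin

text \<open>A predicate on \<open>J\<close> alone, so that one constant serves all t, h, A, B and W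
  and can be fixed before \<delta>. Here \<open>W\<close> stands for the squared norm of v(s),
  \<open>A\<close> for its growth bound and \<open>B\<close> for a crude bound on the last window of
  length \<open>h\<close>.\<close>

definition time_convolution_constant :: "real \<Rightarrow> bool" where
  "time_convolution_constant J \<longleftrightarrow> 0 < J \<and> (\<forall>t h A B W. 0 < t \<longrightarrow> 0 < h \<longrightarrow> 0 \<le> A \<longrightarrow> 0 \<le> B \<longrightarrow>
      (AE s in lborel. 0 < s \<and> s < t \<longrightarrow> W s \<le> A * exp (2 * \<Lambda> * s) + (if t - s \<le> h then B else 0)) \<longrightarrow>
      (\<integral>\<^sup>+s. ennreal (indicator {0<..<t} s * (bD (t - s) * (W s / 2))) \<partial>lborel)
        \<le> ennreal (J * A * exp (2 * \<Lambda> * t) + J * B * exp (3 / 2 * \<Lambda> * t) * h powr (1 / 4)))"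

lemma time_convolution_constantD:
  assumes "time_convolution_constant J" "0 < t" "0 < h" "0 \<le> A" "0 \<le> B"
    "AE s in lborel. 0 < s \<and> s < t \<longrightarrow> W s \<le> A * exp (2 * \<Lambda> * s) + (if t - s \<le> h then B else 0)"
  shows "(\<integral>\<^sup>+s. ennreal (indicator {0<..<t} s * (bD (t - s) * (W s / 2))) \<partial>lborel)
    \<le> ennreal (J * A * exp (2 * \<Lambda> * t) + J * B * exp (3 / 2 * \<Lambda> * t) * h powr (1 / 4))"
  using assms unfolding time_convolution_constant_def by blast

text \<open>With r = t - s, the product exp (3/2 \<Lambda> r) exp (2 \<Lambda> s) equals exp (2
  \<Lambda> t) exp (- \<Lambda> r / 2): the \<open>A\<close> part is governed by a convergent
  integral \<open>I\<close> that does not depend on t. The \<open>B\<close> part integrates r^(-3/4)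
  over the window, giving 4 h^(1/4). In J = cD (I + 2) the sum dominates both coefficients, I/2 and
  4/2.\<close>

lemma time_convolution_constant_exists: "\<exists>J. time_convolution_constant J"
proof -
  obtain I where I: "0 \<le> I"
    "(\<integral>\<^sup>+s. ennreal (indicator {0<..} s * (s powr (- 3 / 4) * exp (- (\<Lambda> / 2 * s)))) \<partial>lborel) = ennreal I"
    using nn_integral_powr_exp_finite[of "\<Lambda> / 2"] \<Lambda>_pos by auto
  define J where "J = cD * (I + 2)"
  have J: "0 < J" using cD_pos I by (simp add: J_def)
  have "(\<integral>\<^sup>+s. ennreal (indicator {0<..<t} s * (bD (t - s) * (W s / 2))) \<partial>lborel)
        \<le> ennreal (J * A * exp (2 * \<Lambda> * t) + J * B * exp (3 / 2 * \<Lambda> * t) * h powr (1 / 4))"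
    if t: "0 < t" and h: "0 < h" and A: "0 \<le> A" and B: "0 \<le> B" and
      W: "AE s in lborel. 0 < s \<and> s < t \<longrightarrow> W s \<le> A * exp (2 * \<Lambda> * s) + (if t - s \<le> h then B else 0)"
    for t h A B W
  proof -
    define p where "p r = ennreal (indicator {0<..} r * (r powr (- 3 / 4) * exp (- (\<Lambda> / 2 * r))))" for r
    define q where "q r = ennreal (indicator {0..h} r * r powr (- 3 / 4))" for r
    define \<alpha> where "\<alpha> = cD * A * exp (2 * \<Lambda> * t) / 2"
    define \<beta> where "\<beta> = cD * B * exp (3 / 2 * \<Lambda> * t) / 2"
    have nn: "0 \<le> \<alpha>" "0 \<le> \<beta>" using A B cD_pos by (auto simp: \<alpha>_def \<beta>_def)
    have [measurable]: "p \<in> borel_measurable borel" "q \<in> borel_measurable borel"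
      unfolding p_def[abs_def] q_def[abs_def] by measurable
    have "(\<integral>\<^sup>+s. ennreal (indicator {0<..<t} s * (bD (t - s) * (W s / 2))) \<partial>lborel)
        \<le> (\<integral>\<^sup>+s. ennreal \<alpha> * p (t + (-1) * s) + ennreal \<beta> * q (t + (-1) * s) \<partial>lborel)"
    proof (rule nn_integral_mono_AE, rule AE_mp[OF W], intro AE_I2 impI)
      fix s assume Ws: "0 < s \<and> s < t \<longrightarrow> W s \<le> A * exp (2 * \<Lambda> * s) + (if t - s \<le> h then B else 0)"
      show "ennreal (indicator {0<..<t} s * (bD (t - s) * (W s / 2))) \<le> ennreal \<alpha> * p (t + (-1) * s) + ennreal \<beta> * q (t + (-1) * s)"
      proof (cases "s \<in> {0<..<t}")
        case True
        define r where "r = t - s"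
        have r: "0 < r" "r < t" using True by (auto simp: r_def)
        define w where "w = r powr (- 3 / 4)"
        have w: "0 \<le> w" by (simp add: w_def)
        have e1: "exp (3 / 2 * \<Lambda> * r) * exp (2 * \<Lambda> * s) = exp (2 * \<Lambda> * t) * exp (- (\<Lambda> / 2 * r))"
          by (simp add: r_def field_simps flip: exp_add)
        have e2: "exp (3 / 2 * \<Lambda> * r) \<le> exp (3 / 2 * \<Lambda> * t)" using r \<Lambda>_pos by simp
        have "bD r * (W s / 2) \<le> bD r * ((A * exp (2 * \<Lambda> * s) + (if r \<le> h then B else 0)) / 2)"
          using Ws True bD_nonneg by (intro mult_left_mono divide_right_mono) (auto simp: r_def)
        also have "\<dots> = cD * A / 2 * w * (exp (3 / 2 * \<Lambda> * r) * exp (2 * \<Lambda> * s))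
            + cD * (if r \<le> h then B else 0) / 2 * w * exp (3 / 2 * \<Lambda> * r)"
          by (simp add: bD_def w_def algebra_simps)
        also have "\<dots> \<le> cD * A / 2 * w * (exp (3 / 2 * \<Lambda> * r) * exp (2 * \<Lambda> * s))
            + cD * (if r \<le> h then B else 0) / 2 * w * exp (3 / 2 * \<Lambda> * t)"
          using cD_pos B w e2 by (intro add_left_mono mult_left_mono) auto
        also have "\<dots> = \<alpha> * (w * exp (- (\<Lambda> / 2 * r))) + \<beta> * (indicator {0..h} r * w)"
          unfolding e1 using r by (simp add: \<alpha>_def \<beta>_def indicator_def ac_simps)
        finally have "ennreal (bD r * (W s / 2)) \<le> ennreal (\<alpha> * (w * exp (- (\<Lambda> / 2 * r))) + \<beta> * (indicator {0..h} r * w))"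
          by (rule ennreal_leI)
        also have "\<dots> = ennreal \<alpha> * p r + ennreal \<beta> * q r"
          using nn w r by (simp add: p_def q_def w_def ennreal_plus ennreal_mult)
        finally show ?thesis using True by (simp add: r_def)
      qed simp
    qed
    also have "\<dots> = ennreal \<alpha> * (\<integral>\<^sup>+s. p (t + (-1) * s) \<partial>lborel) + ennreal \<beta> * (\<integral>\<^sup>+s. q (t + (-1) * s) \<partial>lborel)"
      by (simp add: nn_integral_add nn_integral_cmult)
    also have "(\<integral>\<^sup>+s. p (t + (-1) * s) \<partial>lborel) = ennreal I"
      using nn_integral_real_affine[of p "-1" t] I(2) by (simp add: p_def[abs_def])
    also have "(\<integral>\<^sup>+s. q (t + (-1) * s) \<partial>lborel) = ennreal (4 * h powr (1 / 4))"
      using nn_integral_real_affine[of q "-1" t] nn_integral_powr_near_0[of h] h by (simp add: q_def[abs_def])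
    also have "ennreal \<alpha> * ennreal I + ennreal \<beta> * ennreal (4 * h powr (1 / 4)) = ennreal (\<alpha> * I + \<beta> * (4 * h powr (1 / 4)))"
      using nn I by (subst ennreal_plus) (auto simp: ennreal_mult)
    also have "\<dots> \<le> ennreal (J * A * exp (2 * \<Lambda> * t) + J * B * exp (3 / 2 * \<Lambda> * t) * h powr (1 / 4))"
    proof (rule ennreal_leI, rule add_mono)
      have "\<alpha> * I = (cD * (I / 2)) * (A * exp (2 * \<Lambda> * t))" by (simp add: \<alpha>_def)
      also have "\<dots> \<le> J * (A * exp (2 * \<Lambda> * t))"
        unfolding J_def using cD_pos I A by (intro mult_right_mono mult_left_mono) auto
      finally show "\<alpha> * I \<le> J * A * exp (2 * \<Lambda> * t)" by (simp add: ac_simps)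
      have "\<beta> * (4 * h powr (1 / 4)) = (cD * 2) * (B * exp (3 / 2 * \<Lambda> * t) * h powr (1 / 4))" by (simp add: \<beta>_def)
      also have "\<dots> \<le> J * (B * exp (3 / 2 * \<Lambda> * t) * h powr (1 / 4))"
        unfolding J_def using cD_pos I B by (intro mult_right_mono mult_left_mono) auto
      finally show "\<beta> * (4 * h powr (1 / 4)) \<le> J * B * exp (3 / 2 * \<Lambda> * t) * h powr (1 / 4)" by (simp add: ac_simps)
    qed
    finally show ?thesis .
  qed
  with J show ?thesis unfolding time_convolution_constant_def by blast
qed

text \<open>The norm of \<open>v\<close> is not known to be continuous in time, so the bootstrap advances in steps of a
  fixed length \<open>h\<close>: on the last step only the (large) essential bound \<open>M\<close> is available, but its
  contribution carries the factor \<open>h\<^bsup>1/4\<^esup>\<close>.\<close>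
lemma bootstrap:
  assumes tcc: "time_convolution_constant J"
    and mild: "mild_solution_on a b u T v0 v"
    and t0: "0 < t0" "t0 < T" and \<delta>: "0 < \<delta>" "128 * J * (\<delta> * exp (\<Lambda> * t0)) \<le> 1"
    and S: "\<And>t. 0 < t \<Longrightarrow> t \<le> t0 \<Longrightarrow> S t v0 \<in> borel_measurable borel"
    and upper: "\<And>t. 0 < t \<Longrightarrow> t \<le> t0 \<Longrightarrow>
      (\<integral>\<^sup>+x. ennreal ((norm (S t v0 x))\<^sup>2) \<partial>lborel) \<le> ennreal (3 * (\<delta>\<^sup>2 * exp (2 * \<Lambda> * t)))"
    and lower: "ennreal (7 / 64 * (\<delta>\<^sup>2 * exp (2 * \<Lambda> * t0))) \<le> (\<integral>\<^sup>+x. ennreal ((norm (S t0 v0 x))\<^sup>2) \<partial>lborel)"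
  shows "5 / 128 * (\<delta>\<^sup>2 * exp (2 * \<Lambda> * t0)) \<le> (L2_norm (v t0))\<^sup>2"
proof -
  have J: "0 < J" using tcc by (simp add: time_convolution_constant_def)
  define W where "W s = (L2_norm (v s))\<^sup>2" for s
  have "in_Linf_L2 T v" using mild by (simp add: mild_solution_on_def)
  then obtain C where C: "AE s in lborel. s \<in> {0<..<T} \<longrightarrow> L2_norm (v s) \<le> C"
    by (auto simp: in_Linf_L2_def)
  define B where "B = C\<^sup>2"
  have WB: "AE s in lborel. s \<in> {0<..<T} \<longrightarrow> W s \<le> B"
    using C
  proof (rule AE_mp, intro AE_I2 impI)
    fix s assume "s \<in> {0<..<T} \<longrightarrow> L2_norm (v s) \<le> C" "s \<in> {0<..<T}"
    then have "L2_norm (v s) \<le> C" by blast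
    moreover have "0 \<le> L2_norm (v s)" by (simp add: L2_norm_def)
    ultimately show "W s \<le> B" unfolding W_def B_def by (rule power_mono)
  qed
  have B: "0 \<le> B" by (simp add: B_def)
  define K where "K = J * B * exp (3 / 2 * \<Lambda> * t0)"
  have K: "0 \<le> K" using J B by (simp add: K_def)
  \<comment> \<open>The fourth power undoes \<open>h powr (1 / 4)\<close>, making the last window
    contribute at most \<delta>/16; K + 1 keeps the denominator positive. The step length depends on
    the solution through \<open>B\<close>, but \<open>J\<close>, and with it the threshold, does
    not.\<close>
  define h where "h = (\<delta> / (16 * (K + 1))) ^ 4"
  have h: "0 < h" using \<delta> K by (simp add: h_def)
  have "h powr (1 / 4) = \<delta> / (16 * (K + 1))"
  proof -
    have "h powr (1 / 4) = root 4 h" using h root_powr_inverse[of 4 h] by simp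
    also have "\<dots> = \<delta> / (16 * (K + 1))" unfolding h_def using \<delta> K by (intro real_root_power_cancel) auto
    finally show ?thesis .
  qed
  then have "(K + 1) * h powr (1 / 4) = \<delta> / 16" using K by (simp add: field_simps)
  moreover have "K * h powr (1 / 4) \<le> (K + 1) * h powr (1 / 4)" by (intro mult_right_mono) auto
  ultimately have Kh: "K * h powr (1 / 4) \<le> \<delta> / 16" by simp
  define X where "X t = \<delta>\<^sup>2 * exp (2 * \<Lambda> * t)" for t
  have X_eq: "X t = (\<delta> * exp (\<Lambda> * t))\<^sup>2" for t
    by (simp add: X_def power_mult_distrib flip: exp_double)
  \<comment> \<open>The allowance \<delta> exp (\<Lambda> t) / 8 is shared equally. Older times
    contribute a term quadratic in \<delta> exp (\<Lambda> t), and the smallness condition with 128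
    turns one factor into 1/16; the last window gets the other half.\<close>
  have duhamel: "(\<integral>\<^sup>+s. ennreal (indicator {0<..<t} s * (bD (t - s) * ((L2_norm (v s))\<^sup>2 / 2))) \<partial>lborel)
      \<le> ennreal (\<delta> * exp (\<Lambda> * t) / 8)"
    if t: "0 < t" "t \<le> t0" and prev: "\<And>s. 0 < s \<Longrightarrow> s < t \<Longrightarrow> h < t - s \<Longrightarrow> W s \<le> 8 * X s" for t
  proof -
    have AE: "AE s in lborel. 0 < s \<and> s < t \<longrightarrow> W s \<le> (8 * \<delta>\<^sup>2) * exp (2 * \<Lambda> * s) + (if t - s \<le> h then B else 0)"
      using WB
    proof (rule AE_mp, intro AE_I2 impI)
      fix s assume Ws: "s \<in> {0<..<T} \<longrightarrow> W s \<le> B" and s: "0 < s \<and> s < t"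
      show "W s \<le> (8 * \<delta>\<^sup>2) * exp (2 * \<Lambda> * s) + (if t - s \<le> h then B else 0)"
      proof (cases "t - s \<le> h")
        case True
        have "W s \<le> B" using Ws s t t0 by auto
        moreover have "0 \<le> (8 * \<delta>\<^sup>2) * exp (2 * \<Lambda> * s)" by simp
        ultimately have "0 + W s \<le> (8 * \<delta>\<^sup>2) * exp (2 * \<Lambda> * s) + B" by (rule add_mono[rotated])
        then show ?thesis using True by simp
      next
        case False
        then show ?thesis using prev[of s] s by (simp add: X_def)
      qed
    qed
    have "(\<integral>\<^sup>+s. ennreal (indicator {0<..<t} s * (bD (t - s) * (W s / 2))) \<partial>lborel)
        \<le> ennreal (J * (8 * \<delta>\<^sup>2) * exp (2 * \<Lambda> * t) + J * B * exp (3 / 2 * \<Lambda> * t) * h powr (1 / 4))"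
      by (rule time_convolution_constantD[OF tcc t(1) h _ B AE]) simp
    also have "\<dots> \<le> ennreal (\<delta> * exp (\<Lambda> * t) / 8)"
    proof (rule ennreal_leI)
      have et: "1 \<le> exp (\<Lambda> * t)" "exp (\<Lambda> * t) \<le> exp (\<Lambda> * t0)" using t \<Lambda>_pos by auto
      have "J * (8 * \<delta>\<^sup>2) * exp (2 * \<Lambda> * t) = (8 * J * (\<delta> * exp (\<Lambda> * t))) * (\<delta> * exp (\<Lambda> * t))"
      proof -
        have "exp (2 * \<Lambda> * t) = exp (\<Lambda> * t) * exp (\<Lambda> * t)" by (simp flip: exp_add)
        then show ?thesis by (simp add: power2_eq_square)
      qed
      also have "\<dots> \<le> (8 * J * (\<delta> * exp (\<Lambda> * t0))) * (\<delta> * exp (\<Lambda> * t))"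
        using J \<delta> et by (intro mult_right_mono mult_left_mono) auto
      also have "\<dots> \<le> 1 / 16 * (\<delta> * exp (\<Lambda> * t))"
        using \<delta> by (intro mult_right_mono) auto
      finally have 1: "J * (8 * \<delta>\<^sup>2) * exp (2 * \<Lambda> * t) \<le> \<delta> * exp (\<Lambda> * t) / 16" by simp
      have "J * B * exp (3 / 2 * \<Lambda> * t) * h powr (1 / 4) \<le> K * h powr (1 / 4)"
        unfolding K_def using J B t \<Lambda>_pos by (intro mult_right_mono mult_left_mono) auto
      also have "\<dots> \<le> \<delta> / 16" by (rule Kh)
      also have "\<dots> \<le> \<delta> * exp (\<Lambda> * t) / 16" using et \<delta> by simp
      finally show "J * (8 * \<delta>\<^sup>2) * exp (2 * \<Lambda> * t) + J * B * exp (3 / 2 * \<Lambda> * t) * h powr (1 / 4) \<le> \<delta> * exp (\<Lambda> * t) / 8"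
        using 1 by simp
    qed
    finally show ?thesis by (simp only: W_def)
  qed
  have sq: "(\<delta> * exp (\<Lambda> * t) / 8)\<^sup>2 = X t / 64" for t by (simp add: X_eq power_divide)
  have X0: "0 < X t" for t using \<delta> by (simp add: X_def)
  \<comment> \<open>The loop closes because 2 * 3 + 2/64 is below the 8 assumed for earlier times,
    and the assumption concerns only times more than \<open>h\<close> before t.\<close>
  have step: "W t \<le> 8 * X t"
    if t: "0 < t" "t \<le> t0" and prev: "\<And>s. 0 < s \<Longrightarrow> s < t \<Longrightarrow> h < t - s \<Longrightarrow> W s \<le> 8 * X s" for t
  proof -
    have "t < T" "0 \<le> \<delta> * exp (\<Lambda> * t) / 8" using t t0 \<delta> by auto
    from mild_solution_estimate(1)[OF mild t(1) this(1) S[OF t] duhamel[OF t prev] this(2)]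
    have "ennreal (W t) \<le> 2 * (\<integral>\<^sup>+x. ennreal ((norm (S t v0 x))\<^sup>2) \<partial>lborel) + 2 * ennreal (X t / 64)"
      by (simp only: W_def sq)
    also have "\<dots> \<le> 2 * ennreal (3 * X t) + 2 * ennreal (X t / 64)"
      using upper[OF t] by (intro add_mono mult_left_mono) (auto simp: X_def)
    also have "\<dots> = ennreal (2 * (3 * X t) + 2 * (X t / 64))"
      using X0[of t] by (intro two_ennreal_add_two_ennreal) auto
    finally have "W t \<le> 2 * (3 * X t) + 2 * (X t / 64)" using X0[of t] by (subst (asm) ennreal_le_iff) auto
    then show ?thesis using X0[of t] by simp
  qed
  \<comment> \<open>If t <= (n + 1) h and h < t - s, then s <= n h, so the hypothesis for n covers
    every time that \<open>step\<close> asks about. For n = 0 there is no such t.\<close>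
  have all: "\<forall>t. 0 < t \<and> t \<le> t0 \<and> t \<le> real n * h \<longrightarrow> W t \<le> 8 * X t" for n
  proof (induction n)
    case (Suc n)
    show ?case
    proof (intro allI impI, elim conjE)
      fix t assume t: "0 < t" "t \<le> t0" "t \<le> real (Suc n) * h"
      show "W t \<le> 8 * X t"
      proof (rule step[OF t(1,2)])
        fix s assume "0 < s" "s < t" "h < t - s"
        moreover from this have "s \<le> real n * h" using t by (simp add: algebra_simps)
        ultimately show "W s \<le> 8 * X s" using Suc t by simp
      qed
    qed
  qed simp
  have prev: "W s \<le> 8 * X s" if "0 < s" "s < t0" for s
  proof -
    obtain n :: nat where "s / h \<le> real n" using real_arch_simple by blast
    then have "s \<le> real n * h" using h by (simp add: field_simps)
    then show ?thesis using all[of n] that by simp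
  qed
  have "0 \<le> \<delta> * exp (\<Lambda> * t0) / 8" using \<delta> by simp
  from mild_solution_estimate(2)[OF mild t0 S[OF t0(1) order_refl] duhamel[OF t0(1) order_refl prev] this]
  have "(\<integral>\<^sup>+x. ennreal ((norm (S t0 v0 x))\<^sup>2) \<partial>lborel) \<le> 2 * ennreal (W t0) + 2 * ennreal (X t0 / 64)"
    by (simp only: W_def sq)
  also have "\<dots> = ennreal (2 * W t0 + 2 * (X t0 / 64))"
    using X0[of t0] by (intro two_ennreal_add_two_ennreal) (auto simp: W_def)
  finally have "ennreal (7 / 64 * X t0) \<le> ennreal (2 * W t0 + 2 * (X t0 / 64))"
    using lower unfolding X_def by (rule order_trans[rotated])
  \<comment> \<open>Solving for W leaves (7/64 - 1/32) / 2 = 5/128.\<close>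
  then have "7 / 64 * X t0 \<le> 2 * W t0 + 2 * (X t0 / 64)"
    using X0[of t0] by (subst (asm) ennreal_le_iff) (auto simp: W_def)
  then show ?thesis by (simp add: W_def X_def)
qed

text \<open>The threshold \<epsilon>0 = 1 / (128 J) is the value of \<delta> exp (\<Lambda> t0) at
  which the smallness condition of \<open>bootstrap\<close> becomes an equality. It is fixed before
  the perturbation size.\<close>

lemma constant_state_unstable:
  "\<exists>\<epsilon>>0. \<forall>\<delta>>0. \<exists>(v0 :: real \<Rightarrow> real) t0.
     in_L2 v0 \<and> L2_norm v0 \<le> \<delta> \<and> t0 > 0 \<and>
     (\<forall>v. global_mild_solution a b u v0 v \<longrightarrow> L2_norm (v t0) > \<epsilon>)"
proof -
  obtain J where tcc: "time_convolution_constant J" using time_convolution_constant_exists by blast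
  then have J: "0 < J" by (simp add: time_convolution_constant_def)
  define \<epsilon>0 where "\<epsilon>0 = 1 / (128 * J)"
  have \<epsilon>0: "0 < \<epsilon>0" using J by (simp add: \<epsilon>0_def)
  have "\<exists>(v0 :: real \<Rightarrow> real) t0. in_L2 v0 \<and> L2_norm v0 \<le> \<delta>' \<and> t0 > 0 \<and>
     (\<forall>v. global_mild_solution a b u v0 v \<longrightarrow> L2_norm (v t0) > \<epsilon>0 / 6)" if \<delta>': "0 < \<delta>'" for \<delta>'
  proof -
    \<comment> \<open>The cap \<epsilon>0 / 2 keeps \<delta> below the threshold, so that the
      logarithm defining \<open>t0\<close> is positive.\<close>
    define \<delta> where "\<delta> = min \<delta>' (\<epsilon>0 / 2)"
    have \<delta>: "0 < \<delta>" "\<delta> \<le> \<delta>'" "\<delta> < \<epsilon>0" using \<delta>' \<epsilon>0 by (auto simp: \<delta>_def)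
    define t0 where "t0 = ln (\<epsilon>0 / \<delta>) / \<Lambda>"
    have t0: "0 < t0" using \<delta> \<Lambda>_pos by (simp add: t0_def)
    have "\<Lambda> * t0 = ln (\<epsilon>0 / \<delta>)" using \<Lambda>_pos by (simp add: t0_def)
    then have et0: "\<delta> * exp (\<Lambda> * t0) = \<epsilon>0" using \<delta> \<epsilon>0 by simp
    obtain R where R: "0 < R"
      and up: "\<And>t c. 0 < t \<Longrightarrow> t \<le> t0 \<Longrightarrow>
        (\<integral>\<^sup>+x. ennreal ((norm (S t (\<lambda>x. c * wave R \<xi>max 0 x) x))\<^sup>2) \<partial>lborel)
        \<le> ennreal (3 * (c\<^sup>2 * (R / sqrt 2) * exp (2 * \<Lambda> * t)))"
      and low: "\<And>t c. 0 < t \<Longrightarrow> t \<le> t0 \<Longrightarrow>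
        ennreal (7 / 64 * (c\<^sup>2 * (R / sqrt 2) * exp (2 * \<Lambda> * t)))
        \<le> (\<integral>\<^sup>+x. ennreal ((norm (S t (\<lambda>x. c * wave R \<xi>max 0 x) x))\<^sup>2) \<partial>lborel)"
      using linear_evolution_bounds[OF t0] by blast
    \<comment> \<open>Normalises the amplitude: R / sqrt 2 bounds the squared norm of the wave for
      every phase, so the datum has norm at most \<delta>.\<close>
    define c where "c = \<delta> / sqrt (R / sqrt 2)"
    have c: "c\<^sup>2 * (R / sqrt 2) = \<delta>\<^sup>2" using R by (simp add: c_def power_divide)
    define v0 where "v0 x = c * wave R \<xi>max 0 x" for x
    have "in_L2 v0"
      unfolding in_L2_def v0_def power_mult_distrib using wave_square_integrable[OF R] by simp
    moreover have "L2_norm v0 \<le> \<delta>"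
    proof -
      have "(LINT x|lborel. (v0 x)\<^sup>2) = c\<^sup>2 * (LINT x|lborel. (wave R \<xi>max 0 x)\<^sup>2)"
        unfolding v0_def power_mult_distrib by (rule integral_mult_right_zero)
      also have "\<dots> \<le> c\<^sup>2 * (R / sqrt 2)" by (intro mult_left_mono wave_square_integral_le R) auto
      finally have "(LINT x|lborel. (v0 x)\<^sup>2) \<le> \<delta>\<^sup>2" unfolding c .
      then show ?thesis unfolding L2_norm_def using \<delta> by (simp add: real_le_lsqrt)
    qed
    moreover have "L2_norm (v t0) > \<epsilon>0 / 6" if v: "global_mild_solution a b u v0 v" for v
    proof -
      \<comment> \<open>Mild solutions live on the open interval (0,T), so the horizon must exceed
        \<open>t0\<close>.\<close>
      have "mild_solution_on a b u (t0 + 1) v0 v" using v t0 by (simp add: global_mild_solution_def)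
      then have "5 / 128 * (\<delta>\<^sup>2 * exp (2 * \<Lambda> * t0)) \<le> (L2_norm (v t0))\<^sup>2"
      proof (rule bootstrap[OF tcc _ t0 _ \<delta>(1)])
        show "128 * J * (\<delta> * exp (\<Lambda> * t0)) \<le> 1" unfolding et0 \<epsilon>0_def using J by simp
        show "S t v0 \<in> borel_measurable borel" if "0 < t" for t
          unfolding v0_def by (rule S_wave_measurable[OF that R])
        show "(\<integral>\<^sup>+x. ennreal ((norm (S t v0 x))\<^sup>2) \<partial>lborel) \<le> ennreal (3 * (\<delta>\<^sup>2 * exp (2 * \<Lambda> * t)))"
          if "0 < t" "t \<le> t0" for t
          using up[OF that, of c] unfolding c v0_def .
        show "ennreal (7 / 64 * (\<delta>\<^sup>2 * exp (2 * \<Lambda> * t0))) \<le> (\<integral>\<^sup>+x. ennreal ((norm (S t0 v0 x))\<^sup>2) \<partial>lborel)"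
          using low[OF t0 order_refl, of c] unfolding c v0_def .
      qed simp
      also have "\<delta>\<^sup>2 * exp (2 * \<Lambda> * t0) = (\<delta> * exp (\<Lambda> * t0))\<^sup>2"
        by (simp add: power_mult_distrib flip: exp_double)
      finally have "5 / 128 * \<epsilon>0\<^sup>2 \<le> (L2_norm (v t0))\<^sup>2" unfolding et0 .
      \<comment> \<open>Since 1/36 < 5/128, the final inequality is strict; this is where the
        divisor 6 comes from.\<close>
      moreover have "(\<epsilon>0 / 6)\<^sup>2 < 5 / 128 * \<epsilon>0\<^sup>2" using \<epsilon>0 by (simp add: power_divide)
      ultimately have "(\<epsilon>0 / 6)\<^sup>2 < (L2_norm (v t0))\<^sup>2" by linarith
      then show ?thesis by (rule power2_less_imp_less) (simp add: L2_norm_def)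
    qed
    ultimately show ?thesis using \<delta> t0 by (meson order_trans)
  qed
  then show ?thesis using \<epsilon>0 by (intro exI[of _ "\<epsilon>0 / 6"]) auto
qed

end

theorem theorem1:
  fixes a b u :: real
  assumes "fowler_constants a b"
  shows "\<exists>\<epsilon>>0. \<forall>\<delta>>0. \<exists>(v0 :: real \<Rightarrow> real) t0.
           in_L2 v0 \<and> L2_norm v0 \<le> \<delta> \<and> t0 > 0 \<and>
           (\<forall>v. global_mild_solution a b u v0 v \<longrightarrow> L2_norm (v t0) > \<epsilon>)"
proof -
  interpret fowler a b u using assms by unfold_locales (simp add: fowler_constants_def)
  show ?thesis by (rule constant_state_unstable)
qed

end
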